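(* There exist a universal constant $c>0$ and a polynomial-time algorithm that, given an $N\times N$ sign matrix $S$, outputs a number $s$ satisfying $$\text{sign-rank}(S)\leq s\leq c\cdot\frac{N}{\log N}\cdot \text{sign-rank}(S).$$
   Context: A sign matrix has entries in $\{\pm1\}$. Its sign rank is $\min\{\text{rank}(M):\text{sign}(M)=S\}$ over real matrices $M$ with no zero entries, with $\text{sign}$ applied entrywise and rank over $\mathbb R$. *)

theory Defs
  imports
    Complex_Main
    "HOL-Library.Log_Nat"
    "HOL-Computational_Algebra.Polynomial"
    "Jordan_Normal_Form.DL_Rank"
begin

definition sign_matrices :: "nat \<Rightarrow> nat \<Rightarrow> real mat set" where
  "sign_matrices m n = {S \<in> carrier_mat m n. elements_mat S \<subseteq> {1, -1}}"

definition sign_rank :: "real mat \<Rightarrow> nat" where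
  "sign_rank S = (LEAST r. \<exists>M \<in> carrier_mat (dim_row S) (dim_col S).
     0 \<notin> elements_mat M \<and> map_mat sgn M = S \<and> r = vec_space.rank (dim_row S) M)"

text \<open>
  Polynomial time is measured on a random access machine with registers holding natural
  numbers, under the uniform cost criterion. The only arithmetic operations are addition and
  truncated subtraction, so after \<open>t\<close> steps every register holds a number of bit length
  \<open>O(t + input length)\<close>. This makes uniform-cost polynomial time on this machine coincide with
  polynomial time on Turing machines; a unit-cost multiplication would break this.
\<close>

datatype instr =
    Const nat nat
  | Move nat nat
  | Add nat nat nat
  | Sub nat nat nat
  | Load nat nat
  | Store nat nat
  | Jump nat
  | Jump_Zero nat nat

type_synonym memory = "nat \<Rightarrow> nat"
type_synonym config = "nat \<times> memory"

fun exec_instr :: "instr \<Rightarrow> config \<Rightarrow> config" where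
  "exec_instr (Const i n) (pc, m) = (Suc pc, m(i := n))"
| "exec_instr (Move i j) (pc, m) = (Suc pc, m(i := m j))"
| "exec_instr (Add i j k) (pc, m) = (Suc pc, m(i := m j + m k))"
| "exec_instr (Sub i j k) (pc, m) = (Suc pc, m(i := m j - m k))"
| "exec_instr (Load i j) (pc, m) = (Suc pc, m(i := m (m j)))"
| "exec_instr (Store i j) (pc, m) = (Suc pc, m(m i := m j))"
| "exec_instr (Jump l) (pc, m) = (l, m)"
| "exec_instr (Jump_Zero i l) (pc, m) = (if m i = 0 then l else Suc pc, m)"

definition halted :: "instr list \<Rightarrow> config \<Rightarrow> bool" where
  "halted P c \<longleftrightarrow> fst c \<ge> length P"

definition step :: "instr list \<Rightarrow> config \<Rightarrow> config" where
  "step P c = (if halted P c then c else exec_instr (P ! fst c) c)"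

definition init_config :: "nat list \<Rightarrow> config" where
  "init_config xs = (0, \<lambda>i. if i < length xs then xs ! i else 0)"

text \<open>Total bit length of the input, where the number 0 also takes one bit.\<close>

definition input_length :: "nat list \<Rightarrow> nat" where
  "input_length xs = (\<Sum>x\<leftarrow>xs. max 1 (floorlog 2 x))"

text \<open>The output is the content of register 0 when the machine halts.\<close>

definition poly_time_computable :: "'a set \<Rightarrow> ('a \<Rightarrow> nat list) \<Rightarrow> ('a \<Rightarrow> nat) \<Rightarrow> bool" where
  "poly_time_computable D enc f \<longleftrightarrow>
     (\<exists>P :: instr list. \<exists>p :: nat poly. \<forall>x \<in> D.
        \<exists>t \<le> poly p (input_length (enc x)).
          let c = (step P ^^ t) (init_config (enc x)) in halted P c \<and> snd c 0 = f x)"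

text \<open>An \<open>N \<times> N\<close> sign matrix is presented as \<open>N\<close> followed by its entries in row-major order,
  with 1 encoding \<open>+1\<close> and 0 encoding \<open>-1\<close>.\<close>

definition encode_sign_matrix :: "real mat \<Rightarrow> nat list" where
  "encode_sign_matrix S = dim_row S #
     [if S $$ (i, j) = 1 then 1 else 0. i \<leftarrow> [0..<dim_row S], j \<leftarrow> [0..<dim_col S]]"

end

theory Submission
  imports Defs
begin

text \<open>
  Repeatedly pick two remaining rows that differ on a set of columns of least total weight, double the
  weights of these columns and discard one of the two rows. The chosen pairs form a spanning tree of
  the rows. If \<open>W\<close> is the final total weight, then every column changes sign along at most
  \<open>log\<^sub>2 W\<close> tree edges, hence at most \<open>2 log\<^sub>2 W\<close> times in the order of a depth-first walk. A
  sign pattern with \<open>d\<close> changes is realised by a polynomial of degree \<open>d\<close>, so the sign rank is at most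
  \<open>2 log\<^sub>2 W + 1\<close>.

  Conversely, suppose that any two of \<open>m\<close> rows differ on more than a fraction \<open>\<delta>\<close> of the weight. Choosing
  columns greedily, about \<open>2 ln m / \<delta>\<close> of them already distinguish all these rows. A set of columns
  shattered by the rows has at most \<open>d = sign-rank S\<close> elements, so the Sauer-Shelah lemma
  bounds \<open>m\<close> and yields \<open>\<delta> = O(d / ln m)\<close>. Thus every round multiplies \<open>W\<close> by at most
  \<open>1 + O(d / ln m)\<close>, where \<open>m\<close> is the number of remaining rows, and \<open>ln W = O(d N / ln N)\<close>.
\<close>

section \<open>Sign rank, rank and shattering\<close>

text \<open>This is the multiplicative-weights construction of spanning trees with low crossing
  number. The weights are needed because the degree of the realising polynomials is governed by the
  worst column: short edges alone would only keep the average number of crossings small. Doubling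
  makes columns that were crossed often expensive for later edges, and a column crossed
  \<open>x\<close> times contributes \<open>2 ^ x\<close> to the total weight. A close pair is only
  proved to exist. Since the algorithm takes a pair of least weight, it needs to know neither the
  sign rank nor the fraction that the proof compares it with. The sign rank is bounded from below
  only by the sizes of shattered sets and by 1. The latter, with \<open>N / ln N \<ge> 1\<close>,
  absorbs all additive losses: the initial weight \<open>N\<close>, the roughly
  \<open>sqrt N\<close> last rounds in which the bound on the fraction is trivial, and the rounding
  of the logarithm. The total weight may be exponential in \<open>N\<close>, but it arises by
  additions alone, so its bit length stays polynomial.\<close>

lemma sign_matricesD:
  assumes "S \<in> sign_matrices m n"
  shows "S \<in> carrier_mat m n" "\<And>i j. i < m \<Longrightarrow> j < n \<Longrightarrow> S $$ (i, j) = 1 \<or> S $$ (i, j) = -1"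
  using assms elements_matI[of S m n] unfolding sign_matrices_def by blast+

lemma sign_rank_le:
  assumes S: "S \<in> carrier_mat m n" and M: "M \<in> carrier_mat m n"
    and sgn: "\<And>i j. i < m \<Longrightarrow> j < n \<Longrightarrow> M $$ (i, j) \<noteq> 0 \<and> sgn (M $$ (i, j)) = S $$ (i, j)"
  shows "sign_rank S \<le> vec_space.rank m M"
proof -
  have "0 \<notin> elements_mat M"
    using M sgn by (metis carrier_matD elements_matD)
  moreover have "map_mat sgn M = S"
    using S M sgn by (intro eq_matI) auto
  ultimately show ?thesis
    unfolding sign_rank_def using S M by (intro Least_le) auto
qed

text \<open>\<open>S\<close> realises itself, so \<open>LEAST\<close> ranges over a nonempty set and
  is attained.\<close>

lemma sign_rank_witness:
  assumes S: "S \<in> sign_matrices m n"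
  obtains M where "M \<in> carrier_mat m n" "vec_space.rank m M = sign_rank S"
    "\<And>i j. i < m \<Longrightarrow> j < n \<Longrightarrow> M $$ (i, j) \<noteq> 0 \<and> sgn (M $$ (i, j)) = S $$ (i, j)"
proof -
  note c = sign_matricesD[OF S]
  let ?P = "\<lambda>r. \<exists>M \<in> carrier_mat (dim_row S) (dim_col S).
     0 \<notin> elements_mat M \<and> map_mat sgn M = S \<and> r = vec_space.rank (dim_row S) M"
  have "?P (vec_space.rank (dim_row S) S)"
  proof (intro bexI conjI)
    show "0 \<notin> elements_mat S" using S unfolding sign_matrices_def by auto
    show "map_mat sgn S = S" using c by (intro eq_matI) force+
  qed auto
  then have "?P (sign_rank S)" unfolding sign_rank_def by (rule LeastI)
  then obtain M where M: "M \<in> carrier_mat m n" "0 \<notin> elements_mat M" "map_mat sgn M = S"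
    "sign_rank S = vec_space.rank m M"
    using c by auto
  have "M $$ (i, j) \<noteq> 0 \<and> sgn (M $$ (i, j)) = S $$ (i, j)" if "i < m" "j < n" for i j
    using M that by (metis carrier_matD elements_matI index_map_mat(1))
  with M that show thesis by metis
qed

lemma rank_le_sum_products:
  fixes M :: "'a :: field mat"
  assumes "M \<in> carrier_mat m n"
    and "\<And>i j. i < m \<Longrightarrow> j < n \<Longrightarrow> M $$ (i, j) = (\<Sum>k<d. f k i * g k j)"
  shows "vec_space.rank m M \<le> d"
  using assms
proof (induction d arbitrary: M)
  case 0
  then have "M = 0\<^sub>m m n" by (intro eq_matI) auto
  then show ?case by (simp add: vec_space.rank_0I)
next
  case (Suc d)
  define P where "P = mat m n (\<lambda>(i, j). \<Sum>k<d. f k i * g k j)"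
  define Q where "Q = mat m n (\<lambda>(i, j). f d i * g d j)"
  have "M = P + Q" using Suc.prems by (intro eq_matI) (auto simp: P_def Q_def)
  moreover have "vec_space.rank m P \<le> d" by (rule Suc.IH) (auto simp: P_def)
  moreover have "vec_space.rank m Q \<le> 1"
    by (rule vec_space.rank_le_1_product_entries[of _ _ n "f d" "g d"]) (auto simp: Q_def)
  moreover have "vec_space.rank m (P + Q) \<le> vec_space.rank m P + vec_space.rank m Q"
    by (rule vec_space.rank_subadditive[of _ _ n]) (auto simp: P_def Q_def)
  ultimately show ?case by simp
qed

text \<open>Independence is phrased with entries and indexed coefficients, the form in which it is
  checked later for shattered columns and for a single nonzero column.\<close>

lemma card_le_rank:
  fixes M :: "'a :: field mat"
  assumes M: "M \<in> carrier_mat m n" and J: "J \<subseteq> {..<n}"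
    and indep: "\<And>c. (\<And>i. i < m \<Longrightarrow> (\<Sum>j\<in>J. c j * M $$ (i, j)) = 0) \<Longrightarrow> \<forall>j\<in>J. c j = 0"
  shows "card J \<le> vec_space.rank m M"
proof -
  interpret vec_space "TYPE('a)" m .
  have fin: "finite J" using J finite_subset by blast
  \<comment> \<open>\<open>lin_indpt\<close> concerns the set of columns, in which equal columns
    would merge. The coefficients 1 and -1 on two equal columns form a nontrivial relation.\<close>
  have inj: "inj_on (col M) J"
  proof (rule inj_onI, rule ccontr)
    fix j j' assume jj: "j \<in> J" "j' \<in> J" "col M j = col M j'" "j \<noteq> j'"
    have "(\<Sum>k\<in>J. (if k = j then 1 else if k = j' then -1 else 0) * M $$ (i, k)) = 0"
      if "i < m" for i
    proof -
      have "M $$ (i, j) = M $$ (i, j')"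
        using jj that M J by (metis carrier_matD index_col lessThan_iff subsetD)
      moreover have "(\<Sum>k\<in>J. (if k = j then 1 else if k = j' then -1 else 0) * M $$ (i, k)) =
        (\<Sum>k\<in>J. (if k = j then M $$ (i, k) else 0) - (if k = j' then M $$ (i, k) else 0))"
        using jj by (intro sum.cong) auto
      ultimately show ?thesis using jj(1,2)
        by (simp only: sum_subtractf sum.delta[OF fin] if_True diff_self)
    qed
    from indep[OF this] show False using jj by force
  qed
  have sub: "col M ` J \<subseteq> carrier_vec m" using M by auto
  have "lin_indpt (col M ` J)"
  proof (rule finite_lin_indpt2)
    fix a assume a: "lincomb a (col M ` J) = 0\<^sub>v m"
    have "(\<Sum>j\<in>J. a (col M j) * M $$ (i, j)) = 0" if i: "i < m" for i
    proof -
      have "0 = lincomb a (col M ` J) $ i" using a i by simp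
      also have "\<dots> = (\<Sum>x\<in>col M ` J. a x * x $ i)" by (rule lincomb_index[OF i sub])
      also have "\<dots> = (\<Sum>j\<in>J. a (col M j) * col M j $ i)" by (simp add: sum.reindex[OF inj])
      also have "\<dots> = (\<Sum>j\<in>J. a (col M j) * M $$ (i, j))"
        using J M i by (intro sum.cong) auto
      finally show ?thesis by simp
    qed
    from indep[OF this] show "\<forall>v\<in>col M ` J. a v = 0" by auto
  qed (use fin sub in auto)
  moreover have "col M ` J \<subseteq> set (cols M)" using J M by (auto simp: cols_def)
  ultimately have "card (col M ` J) \<le> rank M" using rank_ge_card_indpt[OF M] by blast
  then show ?thesis by (simp add: card_image[OF inj])
qed

section \<open>The Sauer-Shelah lemma and its numerical form\<close>

lemma card_filter_split:
  assumes "finite A"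
  shows "card A = card {x \<in> A. P x} + card {x \<in> A. \<not> P x}"
proof -
  have "card ({x \<in> A. P x} \<union> {x \<in> A. \<not> P x}) = card {x \<in> A. P x} + card {x \<in> A. \<not> P x}"
    using assms by (intro card_Un_disjoint) auto
  moreover have "{x \<in> A. P x} \<union> {x \<in> A. \<not> P x} = A" by auto
  ultimately show ?thesis by simp
qed

definition shatters :: "'a set set \<Rightarrow> 'a set \<Rightarrow> bool" where
  "shatters F C \<longleftrightarrow> (\<forall>T \<subseteq> C. \<exists>A \<in> F. A \<inter> C = T)"

text \<open>Pajor's form of the Sauer-Shelah lemma. Split at \<open>x\<close>: \<open>F0\<close>
  avoids \<open>x\<close>, and \<open>F1\<close> consists of the sets through \<open>x\<close> with
  \<open>x\<close> removed. A set \<open>C\<close> shattered by either part is shattered by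
  \<open>F\<close>; if both parts shatter it, then \<open>F\<close> also shatters
  \<open>insert x C\<close>, which pays for counting \<open>C\<close> twice.\<close>

lemma card_le_card_shattered:
  assumes "finite X" "F \<subseteq> Pow X"
  shows "card F \<le> card {C \<in> Pow X. shatters F C}"
  using assms
proof (induction X arbitrary: F rule: finite_induct)
  case empty
  then have "F = {} \<or> F = {{}}" by auto
  then show ?case
  proof
    assume "F = {{}}"
    then have "{C \<in> Pow {}. shatters F C} = {{}}" by (auto simp: shatters_def)
    with \<open>F = {{}}\<close> show ?thesis by simp
  qed simp
next
  case (insert x X)
  define F0 where "F0 = {A \<in> F. x \<notin> A}"
  define F1 where "F1 = (\<lambda>A. A - {x}) ` {A \<in> F. x \<in> A}"
  define sh where "sh G = {C \<in> Pow X. shatters G C}" for G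
  have fin: "finite F" "finite (sh G)" for G
    using insert by (auto simp: sh_def intro: finite_subset[of F "Pow (insert x X)"])
  have "inj_on (\<lambda>A. A - {x}) {A \<in> F. x \<in> A}"
    by (rule inj_onI) blast
  then have "card F1 = card {A \<in> F. x \<in> A}"
    unfolding F1_def by (rule card_image)
  moreover have "card F = card F0 + card {A \<in> F. x \<in> A}"
    unfolding F0_def using card_filter_split[OF fin(1), of "\<lambda>A. x \<in> A"] by simp
  ultimately have "card F = card F0 + card F1" by simp
  also have "\<dots> \<le> card (sh F0) + card (sh F1)"
  proof (rule add_mono)
    show "card F0 \<le> card (sh F0)"
      unfolding sh_def by (rule insert.IH) (use insert.prems in \<open>auto simp: F0_def\<close>)
    show "card F1 \<le> card (sh F1)"
      unfolding sh_def by (rule insert.IH) (use insert.prems in \<open>auto simp: F1_def\<close>)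
  qed
  also have "\<dots> = card (sh F0 \<union> sh F1) + card (sh F0 \<inter> sh F1)"
    using fin by (intro card_Un_Int)
  also have "card (sh F0 \<inter> sh F1) = card (insert x ` (sh F0 \<inter> sh F1))"
    using insert.hyps by (intro card_image[symmetric] inj_onI) (auto simp: sh_def)
  also have "card (sh F0 \<union> sh F1) + card (insert x ` (sh F0 \<inter> sh F1)) =
      card ((sh F0 \<union> sh F1) \<union> insert x ` (sh F0 \<inter> sh F1))"
    using fin insert.hyps by (intro card_Un_disjoint[symmetric]) (auto simp: sh_def)
  also have "\<dots> \<le> card {C \<in> Pow (insert x X). shatters F C}"
  proof (rule card_mono)
    show "finite {C \<in> Pow (insert x X). shatters F C}" using insert.hyps by simp
    have "shatters F C" if "C \<in> sh F0" for C
      using that unfolding sh_def shatters_def F0_def by blast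
    moreover have "shatters F C" if C: "C \<in> sh F1" for C
      unfolding shatters_def
    proof (intro allI impI)
      fix T assume "T \<subseteq> C"
      then obtain A where "A \<in> F" "(A - {x}) \<inter> C = T"
        using C unfolding sh_def shatters_def F1_def by blast
      moreover have "x \<notin> C" using C insert.hyps by (auto simp: sh_def)
      ultimately show "\<exists>A\<in>F. A \<inter> C = T" by blast
    qed
    moreover have "shatters F (insert x C)" if C: "C \<in> sh F0" "C \<in> sh F1" for C
      unfolding shatters_def
    proof (intro allI impI)
      fix T assume T: "T \<subseteq> insert x C"
      have x: "x \<notin> C" using C insert.hyps by (auto simp: sh_def)
      show "\<exists>A\<in>F. A \<inter> insert x C = T"
      proof (cases "x \<in> T")
        case True
        have "T - {x} \<subseteq> C" using T by auto
        then obtain A where "A \<in> F" "x \<in> A" "(A - {x}) \<inter> C = T - {x}"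
          using C(2) unfolding sh_def shatters_def F1_def by blast
        then show ?thesis using True x by blast
      next
        case False
        then have "T \<subseteq> C" using T by auto
        then obtain A where "A \<in> F" "x \<notin> A" "A \<inter> C = T"
          using C(1) unfolding sh_def shatters_def F0_def by blast
        then show ?thesis using False by blast
      qed
    qed
    ultimately show "sh F0 \<union> sh F1 \<union> insert x ` (sh F0 \<inter> sh F1)
        \<subseteq> {C \<in> Pow (insert x X). shatters F C}"
      by (auto simp: sh_def)
  qed
  finally show ?case .
qed

text \<open>With \<open>x = d / k \<le> 1\<close>, replacing \<open>x ^ d\<close> by
  \<open>x ^ i\<close> for \<open>i \<le> d\<close> only increases the terms, and the full binomial
  sum is \<open>(1 + x) ^ k \<le> exp 1 ^ d\<close>. Dividing by \<open>x ^ d\<close> gives the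
  bound.\<close>

lemma sum_choose_le:
  fixes d k :: nat
  assumes "0 < d" "d \<le> k"
  shows "(\<Sum>i\<le>d. real (k choose i)) \<le> (exp 1 * real k / real d) ^ d"
proof -
  define x where "x = real d / real k"
  have x: "0 < x" "x \<le> 1" using assms by (auto simp: x_def)
  have "x ^ d * (\<Sum>i\<le>d. real (k choose i)) = (\<Sum>i\<le>d. real (k choose i) * x ^ d)"
    by (simp add: sum_distrib_left mult.commute)
  also have "\<dots> \<le> (\<Sum>i\<le>d. real (k choose i) * x ^ i)"
    using x by (intro sum_mono mult_left_mono power_decreasing) auto
  also have "\<dots> \<le> (\<Sum>i\<le>k. real (k choose i) * x ^ i)"
    using assms x by (intro sum_mono2) auto
  also have "\<dots> = (x + 1) ^ k" by (subst binomial_ring) simp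
  also have "\<dots> \<le> exp x ^ k" using x by (intro power_mono) (auto simp: add.commute)
  also have "\<dots> = exp 1 ^ d" using assms by (simp add: x_def flip: exp_of_nat_mult)
  finally have "(\<Sum>i\<le>d. real (k choose i)) \<le> exp 1 ^ d / x ^ d"
    using x by (simp add: field_simps)
  also have "\<dots> = (exp 1 * real k / real d) ^ d" by (simp add: x_def flip: power_divide)
  finally show ?thesis .
qed

text \<open>\<open>k\<close> is decoupled from \<open>card X\<close> because in the application only
  an upper bound on the number of chosen columns is known.\<close>

lemma card_shattered_bound:
  assumes "finite X" "F \<subseteq> Pow X" and sh: "\<And>C. C \<subseteq> X \<Longrightarrow> shatters F C \<Longrightarrow> card C \<le> d"
    and "0 < d" "d \<le> k" "card X \<le> k"
  shows "real (card F) \<le> (exp 1 * real k / real d) ^ d"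
proof -
  have "card F \<le> card {C \<in> Pow X. shatters F C}"
    using assms by (intro card_le_card_shattered)
  also have "\<dots> \<le> card (\<Union>i\<le>d. {C. C \<subseteq> X \<and> card C = i})"
    using sh \<open>finite X\<close> by (intro card_mono) auto
  also have "\<dots> \<le> (\<Sum>i\<le>d. card {C. C \<subseteq> X \<and> card C = i})"
    by (rule card_UN_le) simp
  also have "\<dots> = (\<Sum>i\<le>d. card X choose i)"
    using \<open>finite X\<close> by (simp add: n_subsets)
  also have "\<dots> \<le> (\<Sum>i\<le>d. k choose i)"
    using assms by (intro sum_mono binomial_right_mono) auto
  finally have "real (card F) \<le> real (\<Sum>i\<le>d. k choose i)" by (simp only: of_nat_le_iff)
  also have "\<dots> \<le> (exp 1 * real k / real d) ^ d"
    using sum_choose_le[OF \<open>0 < d\<close> \<open>d \<le> k\<close>] by simp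
  finally show ?thesis .
qed

section \<open>Two rows that differ on little weight\<close>

text \<open>Averaging: every item is separated by a fraction \<delta> of the weight, so some column
  separates at least that fraction of the items still unseparated. Each chosen column thus shrinks
  their number by the factor \<open>1 - \<delta>\<close>.\<close>

lemma few_columns_separate:
  fixes w :: "'j \<Rightarrow> real"
  assumes "finite Z" "finite J" and w: "\<And>j. j \<in> J \<Longrightarrow> 0 \<le> w j"
    and W: "0 < (\<Sum>j\<in>J. w j)" and "\<delta> \<le> 1"
    and sep: "\<And>z. z \<in> Z \<Longrightarrow> \<delta> * (\<Sum>j\<in>J. w j) \<le> (\<Sum>j\<in>{j\<in>J. sep z j}. w j)"
  shows "\<exists>C \<subseteq> J. card C \<le> k \<and>
    real (card {z\<in>Z. \<forall>j\<in>C. \<not> sep z j}) \<le> (1 - \<delta>) ^ k * real (card Z)"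
proof (induction k)
  case 0
  show ?case by (intro exI[of _ "{}"]) auto
next
  case (Suc k)
  then obtain C where C: "C \<subseteq> J" "card C \<le> k"
    "real (card {z\<in>Z. \<forall>j\<in>C. \<not> sep z j}) \<le> (1 - \<delta>) ^ k * real (card Z)" by blast
  define Y where "Y = {z\<in>Z. \<forall>j\<in>C. \<not> sep z j}"
  have finY: "finite Y" using assms(1) by (simp add: Y_def)
  have "\<exists>j\<in>J. \<delta> * real (card Y) \<le> real (card {z\<in>Y. sep z j})"
  proof (rule ccontr)
    assume "\<not> ?thesis"
    then have less: "real (card {z\<in>Y. sep z j}) < \<delta> * real (card Y)" if "j \<in> J" for j
      using that by force
    \<comment> \<open>A column of positive weight makes the double count below strict.\<close>
    obtain j0 where j0: "j0 \<in> J" "0 < w j0"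
      using W w by (metis not_less sum_nonpos)
    \<comment> \<open>The weight of all pairs of an item and a column separating it is counted by
      items, then by columns.\<close>
    have "(\<Sum>z\<in>Y. \<delta> * (\<Sum>j\<in>J. w j)) \<le> (\<Sum>z\<in>Y. \<Sum>j\<in>{j\<in>J. sep z j}. w j)"
      using sep by (intro sum_mono) (auto simp: Y_def)
    also have "\<dots> = (\<Sum>z\<in>Y. \<Sum>j\<in>J. if sep z j then w j else 0)"
      using assms(2) by (intro sum.cong refl sum.inter_filter)
    also have "\<dots> = (\<Sum>j\<in>J. \<Sum>z\<in>Y. if sep z j then w j else 0)"
      by (rule sum.swap)
    also have "\<dots> = (\<Sum>j\<in>J. w j * real (card {z\<in>Y. sep z j}))"
      using finY by (intro sum.cong) (auto simp flip: sum.inter_filter)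
    also have "\<dots> < (\<Sum>j\<in>J. w j * (\<delta> * real (card Y)))"
    proof (rule sum_strict_mono_ex1[OF assms(2)])
      show "\<forall>j\<in>J. w j * real (card {z\<in>Y. sep z j}) \<le> w j * (\<delta> * real (card Y))"
        using less w by (meson less_imp_le mult_left_mono)
      show "\<exists>j\<in>J. w j * real (card {z\<in>Y. sep z j}) < w j * (\<delta> * real (card Y))"
        using j0 less by (intro bexI[of _ j0] mult_strict_left_mono) auto
    qed
    finally show False by (simp add: sum_distrib_right algebra_simps flip: sum_distrib_left)
  qed
  then obtain j where j: "j \<in> J" "\<delta> * real (card Y) \<le> real (card {z\<in>Y. sep z j})" by blast
  have "card Y = card {z\<in>Y. sep z j} + card {z\<in>Y. \<not> sep z j}"
    by (rule card_filter_split[OF finY])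
  then have "real (card {z\<in>Y. \<not> sep z j}) \<le> (1 - \<delta>) * real (card Y)"
    using j by (simp add: algebra_simps)
  also have "\<dots> \<le> (1 - \<delta>) * ((1 - \<delta>) ^ k * real (card Z))"
    using C(3) \<open>\<delta> \<le> 1\<close> by (intro mult_left_mono) (auto simp: Y_def)
  finally have "real (card {z\<in>Y. \<not> sep z j}) \<le> (1 - \<delta>) ^ Suc k * real (card Z)" by simp
  moreover have "{z\<in>Y. \<not> sep z j} = {z\<in>Z. \<forall>j\<in>insert j C. \<not> sep z j}"
    by (auto simp: Y_def)
  moreover have "card (insert j C) \<le> Suc k"
    using C(2) finite_subset[OF C(1) assms(2)] by (simp add: card_insert_if)
  ultimately show ?case using C(1) j(1)
    by (intro exI[of _ "insert j C"]) auto
qed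

text \<open>Given a linear relation \<open>c\<close> on the columns in \<open>C\<close> of a
  realising matrix, shattering supplies a row whose signs agree with those of the nonzero
  coefficients. All nonzero summands of the relation are positive in this row, so there are none,
  and the columns are independent.\<close>

lemma shattered_card_le_sign_rank:
  assumes S: "S \<in> sign_matrices m n" and C: "C \<subseteq> {..<n}" and R: "R \<subseteq> {..<m}"
    and sh: "shatters ((\<lambda>i. {j \<in> X. S $$ (i, j) = 1}) ` R) C" and CX: "C \<subseteq> X"
  shows "card C \<le> sign_rank S"
proof -
  obtain M where M: "M \<in> carrier_mat m n" "vec_space.rank m M = sign_rank S"
    "\<And>i j. i < m \<Longrightarrow> j < n \<Longrightarrow> M $$ (i, j) \<noteq> 0 \<and> sgn (M $$ (i, j)) = S $$ (i, j)"
    using sign_rank_witness[OF S] by blast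
  have "card C \<le> vec_space.rank m M"
  proof (rule card_le_rank[OF M(1) C], rule ballI, rule ccontr)
    fix c :: "nat \<Rightarrow> real" and j
    assume c: "\<And>i. i < m \<Longrightarrow> (\<Sum>j\<in>C. c j * M $$ (i, j)) = 0" and j: "j \<in> C" "c j \<noteq> 0"
    have "\<exists>A \<in> (\<lambda>i. {j \<in> X. S $$ (i, j) = 1}) ` R. A \<inter> C = {j \<in> C. 0 < c j}"
      using sh unfolding shatters_def by auto
    then obtain i where i: "i \<in> R" "{j \<in> X. S $$ (i, j) = 1} \<inter> C = {j \<in> C. 0 < c j}"
      by blast
    have im: "i < m" using i R by auto
    have pos: "0 < c k * M $$ (i, k)" if "k \<in> C" "c k \<noteq> 0" for k
    proof -
      have k: "k < n" using that C by auto
      have "S $$ (i, k) = 1 \<longleftrightarrow> 0 < c k" using i that CX by blast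
      then have "0 < M $$ (i, k) \<longleftrightarrow> 0 < c k" using M(3)[OF im k] by (auto simp: sgn_1_pos)
      then show ?thesis using M(3)[OF im k] that
        by (metis linorder_neqE_linordered_idom mult_neg_neg mult_pos_pos)
    qed
    have "0 < (\<Sum>k\<in>C. c k * M $$ (i, k))"
    proof (rule sum_pos2)
      show "finite C" using C finite_subset by blast
      show "j \<in> C" "0 < c j * M $$ (i, j)" using j pos by auto
      show "0 \<le> c k * M $$ (i, k)" if "k \<in> C" for k
        using pos[OF that] by (cases "c k = 0") auto
    qed
    then show False using c[OF im] by simp
  qed
  then show ?thesis using M(2) by simp
qed

lemma sign_rank_pos:
  assumes S: "S \<in> sign_matrices m n" and "0 < m" "0 < n"
  shows "0 < sign_rank S"
proof -
  obtain M where M: "M \<in> carrier_mat m n" "vec_space.rank m M = sign_rank S"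
    "\<And>i j. i < m \<Longrightarrow> j < n \<Longrightarrow> M $$ (i, j) \<noteq> 0 \<and> sgn (M $$ (i, j)) = S $$ (i, j)"
    using sign_rank_witness[OF S] by blast
  have "card {0::nat} \<le> vec_space.rank m M"
    by (rule card_le_rank[OF M(1)]) (use M(3) assms in force)+
  then show ?thesis using M(2) by simp
qed

text \<open>Only used for \<open>m \<ge> 2\<close>: at \<open>m = 1\<close> the quotient has the junk value 0.\<close>

definition close_frac :: "nat \<Rightarrow> nat \<Rightarrow> real" where
  "close_frac d m = min 1 (12 * real d / ln (real m))"

text \<open>The square root of the claim, \<open>y < exp (y / 2)\<close>, follows from the quadratic
  Taylor polynomial, whose excess over \<open>y\<close> is
  \<open>((y - 2) ^ 2 + 4) / 8\<close>.\<close>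

lemma square_less_exp:
  fixes y :: real
  assumes "0 \<le> y"
  shows "y ^ 2 < exp y"
proof -
  have "0 \<le> (y - 2)\<^sup>2" by simp
  then have "y < 1 + y / 2 + (y / 2)\<^sup>2 / 2" by (simp add: power2_eq_square algebra_simps)
  also have "\<dots> \<le> exp (y / 2)" using assms by (intro exp_lower_Taylor_quadratic) simp
  finally have "y ^ 2 < exp (y / 2) ^ 2" using assms by (intro power_strict_mono) auto
  then show ?thesis by (simp flip: exp_double)
qed

lemma exists_close_pair:
  fixes w :: "nat \<Rightarrow> real"
  assumes S: "S \<in> sign_matrices m n" and A: "A \<subseteq> {..<m}" "2 \<le> card A"
    and w: "\<And>j. j < n \<Longrightarrow> 0 < w j" and n: "0 < n"
  shows "\<exists>a\<in>A. \<exists>b\<in>A. a \<noteq> b \<and>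
    (\<Sum>j | j < n \<and> S $$ (a, j) \<noteq> S $$ (b, j). w j) \<le> close_frac (sign_rank S) (card A) * (\<Sum>j<n. w j)"
proof (rule ccontr)
  assume "\<not> ?thesis"
  then have far: "close_frac (sign_rank S) (card A) * (\<Sum>j<n. w j)
      < (\<Sum>j | j < n \<and> S $$ (a, j) \<noteq> S $$ (b, j). w j)"
    if "a \<in> A" "b \<in> A" "a \<noteq> b" for a b
    using that by force
  define d where "d = sign_rank S"
  define \<delta> where "\<delta> = close_frac d (card A)"
  define l where "l = ln (real (card A))"
  have l: "0 < l" using A by (simp add: l_def)
  have finA: "finite A" using A(1) finite_subset by blast
  obtain a0 b0 where ab0: "a0 \<in> A" "b0 \<in> A" "a0 \<noteq> b0"
    using A(2) by (meson card_2_iff' obtain_subset_with_card_n subsetD)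
  have d: "0 < d" unfolding d_def using ab0 A n by (intro sign_rank_pos[OF S]) auto
  have W: "0 < (\<Sum>j<n. w j)" using w n by (intro sum_pos) auto
  \<comment> \<open>No pair differs on more than the whole weight, so the cap 1 in
    \<open>close_frac\<close> is not attained, and \<open>12 * d < l\<close> becomes
    available.\<close>
  have "(\<Sum>j | j < n \<and> S $$ (a0, j) \<noteq> S $$ (b0, j). w j) \<le> (\<Sum>j<n. w j)"
    using w by (intro sum_mono2) (auto intro: less_imp_le)
  with far[OF ab0] have "\<delta> * (\<Sum>j<n. w j) < 1 * (\<Sum>j<n. w j)"
    by (simp add: \<delta>_def d_def)
  then have "\<delta> < 1" using W mult_less_cancel_right_pos by blast
  then have \<delta>: "\<delta> = 12 * real d / l" by (auto simp: \<delta>_def close_frac_def l_def min_def split: if_splits)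
  have l12: "12 * real d < l" using \<open>\<delta> < 1\<close> l by (simp add: \<delta>)
  have \<delta>pos: "0 < \<delta>" using d l by (simp add: \<delta>)
  \<comment> \<open>Chosen so that \<open>(1 - \<delta>) ^ k \<le> exp (- \<delta> * k) \<le> 1 /
    card A ^ 2\<close>, which leaves less than one unseparated ordered pair.\<close>
  define k where "k = nat \<lceil>2 * l / \<delta>\<rceil>"
  have k: "2 * l / \<delta> \<le> real k" "real k \<le> 2 * l / \<delta> + 1"
    using l \<delta>pos by (auto simp: k_def)
  define Z where "Z = {z \<in> A \<times> A. fst z \<noteq> snd z}"
  define sep where "sep z j \<longleftrightarrow> S $$ (fst z, j) \<noteq> S $$ (snd z, j)" for z :: "nat \<times> nat" and j
  have "\<exists>C \<subseteq> {..<n}. card C \<le> k \<and>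
    real (card {z\<in>Z. \<forall>j\<in>C. \<not> sep z j}) \<le> (1 - \<delta>) ^ k * real (card Z)"
  proof (rule few_columns_separate[where w = w])
    show "\<delta> * (\<Sum>j<n. w j) \<le> (\<Sum>j\<in>{j\<in>{..<n}. sep z j}. w j)" if "z \<in> Z" for z
      using that far[of "fst z" "snd z"] by (auto simp: Z_def sep_def \<delta>_def d_def intro: less_imp_le)
  qed (use finA w W \<open>\<delta> < 1\<close> in \<open>auto simp: Z_def intro: less_imp_le\<close>)
  then obtain C where C: "C \<subseteq> {..<n}" "card C \<le> k"
    "real (card {z\<in>Z. \<forall>j\<in>C. \<not> sep z j}) \<le> (1 - \<delta>) ^ k * real (card Z)" by blast
  \<comment> \<open>The missing diagonal supplies the strictness, since
    \<open>exp (- 2 * l) * card A ^ 2\<close> is exactly 1.\<close>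
  have "real (card Z) < real (card A) ^ 2"
  proof -
    have "(a0, a0) \<in> A \<times> A" "(a0, a0) \<notin> Z" "Z \<subseteq> A \<times> A" using ab0 by (auto simp: Z_def)
    then have "Z \<subset> A \<times> A" by blast
    then have "card Z < card (A \<times> A)" using finA by (intro psubset_card_mono) auto
    then have "real (card Z) < real (card (A \<times> A))" by (simp only: of_nat_less_iff)
    then show ?thesis by (simp only: card_cartesian_product of_nat_mult power2_eq_square)
  qed
  moreover have "(1 - \<delta>) ^ k \<le> exp (- 2 * l)"
  proof -
    have "(1 - \<delta>) ^ k \<le> exp (- \<delta>) ^ k"
      using \<open>\<delta> < 1\<close> exp_ge_add_one_self[of "- \<delta>"] by (intro power_mono) auto
    also have "\<dots> = exp (- (\<delta> * real k))" by (simp add: mult.commute flip: exp_of_nat_mult)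
    also have "\<dots> \<le> exp (- 2 * l)" using k \<delta>pos by (simp add: field_simps)
    finally show ?thesis .
  qed
  moreover have "exp (- 2 * l) * real (card A) ^ 2 = 1"
  proof -
    have "exp l = real (card A)" using A by (simp add: l_def)
    then have "exp (2 * l) = real (card A) ^ 2" by (simp add: exp_double)
    moreover have "card A \<noteq> 0" using A by simp
    ultimately show ?thesis by (simp add: exp_minus)
  qed
  ultimately have "(1 - \<delta>) ^ k * real (card Z) < 1"
    using mult_right_mono[of "(1 - \<delta>) ^ k" "exp (- 2 * l)" "real (card Z)"]
      mult_strict_left_mono[of "real (card Z)" "real (card A) ^ 2" "exp (- 2 * l)"] by simp
  then have "real (card {z\<in>Z. \<forall>j\<in>C. \<not> sep z j}) < 1" using C(3) by simp
  then have "card {z\<in>Z. \<forall>j\<in>C. \<not> sep z j} = 0" by simp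
  moreover have "finite Z" using finA by (simp add: Z_def)
  ultimately have none: "{z\<in>Z. \<forall>j\<in>C. \<not> sep z j} = {}" by simp
  define F where "F i = {j \<in> C. S $$ (i, j) = 1}" for i
  \<comment> \<open>As \<open>C\<close> separates all pairs, the rows of \<open>A\<close> have
    distinct traces on \<open>C\<close>, so the bound on set families applies to
    \<open>card A\<close> itself.\<close>
  have "inj_on F A"
  proof (rule inj_onI, rule ccontr)
    fix a b assume ab: "a \<in> A" "b \<in> A" "F a = F b" "a \<noteq> b"
    have "(a, b) \<in> Z" using ab by (simp add: Z_def)
    then obtain j where j: "j \<in> C" "S $$ (a, j) \<noteq> S $$ (b, j)" using none by (auto simp: sep_def)
    then have "S $$ (a, j) = 1 \<longleftrightarrow> S $$ (b, j) = 1" using ab(3) by (auto simp: F_def)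
    moreover have "a < m" "b < m" "j < n" using ab j A C by auto
    ultimately show False using j(2) sign_matricesD(2)[OF S] by metis
  qed
  then have "real (card A) = real (card (F ` A))" by (simp add: card_image)
  also have "\<dots> \<le> (exp 1 * real k / real d) ^ d"
  proof (rule card_shattered_bound[where X = C])
    show "finite C" using C finite_subset by blast
    show "F ` A \<subseteq> Pow C" by (auto simp: F_def)
    show "card D \<le> d" if "D \<subseteq> C" "shatters (F ` A) D" for D
      unfolding d_def by (rule shattered_card_le_sign_rank[OF S, of _ A C])
        (use that A C in \<open>auto simp: F_def[abs_def]\<close>)
    have "real d \<le> l" using l12 d by simp
    also have "l * \<delta> \<le> l * 2" using l \<open>\<delta> < 1\<close> by (intro mult_left_mono) auto
    then have "l \<le> 2 * l / \<delta>" using \<delta>pos by (simp add: field_simps)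
    finally show "d \<le> k" using k by linarith
  qed (use d C in auto)
  finally have cardA: "real (card A) \<le> (exp 1 * real k / real d) ^ d" .
  \<comment> \<open>Since \<open>card A = exp y ^ d\<close>, a \<open>d\<close>-th root leaves
    \<open>exp y \<le> exp 1 * k / d\<close>. As \<open>2 * l / \<delta> = l ^ 2 / (6 * d)\<close>,
    the right side is at most \<open>3 * (y ^ 2 / 6 + y ^ 2 / 12)\<close>. The constant 12 of
    \<open>close_frac\<close> is large enough to push this below
    \<open>y ^ 2 < exp y\<close>.\<close>
  define y where "y = l / real d"
  have y: "12 < y" using l12 d by (simp add: y_def field_simps)
  have "real (card A) = exp y ^ d"
    using d A by (simp add: y_def l_def flip: exp_of_nat_mult)
  with cardA have "exp y \<le> exp 1 * real k / real d"
    using d by (metis (no_types, lifting) power_mono_iff exp_ge_zero divide_nonneg_nonneg mult_nonneg_nonneg of_nat_0_le_iff)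
  also have "\<dots> \<le> 3 * (y ^ 2 / 4)"
  proof -
    have "real k / real d \<le> (2 * l / \<delta> + 1) / real d" using k by (intro divide_right_mono) auto
    also have "\<dots> = y ^ 2 / 6 + 1 / real d" using d l
      by (simp add: \<delta> y_def field_simps power2_eq_square)
    also have "\<dots> \<le> y ^ 2 / 6 + 1" using d by simp
    also have "1 \<le> y ^ 2 / 12" using y power_mono[of 12 y 2] by simp
    finally have "real k / real d \<le> y ^ 2 / 4" by simp
    then show ?thesis using mult_mono[OF exp_le, of "real k / real d" "y ^ 2 / 4"] by simp
  qed
  also have "\<dots> \<le> y ^ 2" by simp
  also have "\<dots> < exp y" using y by (intro square_less_exp) simp
  finally show False by simp
qed

section \<open>Sign changes and the greedy merging of rows\<close>

fun sign_changes :: "('a \<Rightarrow> 'b) \<Rightarrow> 'a list \<Rightarrow> nat" where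
  "sign_changes f (x # y # zs) = (if f x = f y then 0 else 1) + sign_changes f (y # zs)"
| "sign_changes f _ = 0"

text \<open>The step from the last entry back to the first is counted too. The cost of joining two
  closed walks then depends only on their heads, which are the surviving rows.\<close>

definition cyclic_changes :: "('a \<Rightarrow> 'b) \<Rightarrow> 'a list \<Rightarrow> nat" where
  "cyclic_changes f xs = sign_changes f (xs @ [hd xs])"

lemma sign_changes_append:
  "sign_changes f (xs @ y # ys) = sign_changes f (xs @ [y]) + sign_changes f (y # ys)"
proof (induction xs)
  case (Cons x xs)
  then show ?case by (cases xs) auto
qed simp

lemma sign_changes_snoc:
  "xs \<noteq> [] \<Longrightarrow> sign_changes f (xs @ [y]) = sign_changes f xs + (if f (last xs) = f y then 0 else 1)"
proof (induction xs)
  case (Cons x xs)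
  then show ?case by (cases xs) auto
qed simp

lemma sign_changes_replace_last:
  "sign_changes f (xs @ [b]) \<le> sign_changes f (xs @ [a]) + (if f a = f b then 0 else 1)"
  by (cases "xs = []") (auto simp: sign_changes_snoc)

text \<open>Joining replaces the two closing steps, one to each head, by steps to the other head.
  Each replacement adds at most one change, and none if \<open>f\<close> agrees on the
  heads.\<close>

lemma cyclic_changes_append:
  assumes "xs \<noteq> []" "ys \<noteq> []"
  shows "cyclic_changes f (xs @ ys) \<le>
    cyclic_changes f xs + cyclic_changes f ys + 2 * (if f (hd xs) = f (hd ys) then 0 else 1)"
proof -
  obtain b zs where ys: "ys = b # zs" using assms by (cases ys) auto
  have "cyclic_changes f (xs @ ys) = sign_changes f (xs @ [b]) + sign_changes f (ys @ [hd xs])"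
    using assms by (simp add: cyclic_changes_def ys) (subst sign_changes_append, simp)
  then show ?thesis
    using sign_changes_replace_last[of f xs b "hd xs"]
      sign_changes_replace_last[of f ys "hd xs" b]
    by (auto simp: cyclic_changes_def ys split: if_splits)
qed

lemma sign_changes_le_cyclic: "sign_changes f xs \<le> cyclic_changes f xs"
  by (cases "xs = []") (auto simp: cyclic_changes_def sign_changes_snoc)

section \<open>From few sign changes to small sign rank\<close>

text \<open>The third conjunct strengthens the induction: beyond the last position the sign never
  changes again. So an entry equal to its predecessor costs nothing, and a different one costs a
  single linear factor.\<close>

lemma poly_with_sign_pattern:
  fixes f :: "'a \<Rightarrow> real"
  assumes "xs \<noteq> []" "\<And>x. x \<in> set xs \<Longrightarrow> f x = 1 \<or> f x = -1"
  shows "\<exists>p. degree p \<le> sign_changes f xs \<and>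
    (\<forall>k < length xs. sgn (poly p (real k)) = f (xs ! k)) \<and>
    (\<forall>t. real (length xs) \<le> t + 1 \<longrightarrow> sgn (poly p t) = f (last xs))"
  using assms
proof (induction xs rule: rev_nonempty_induct)
  case (single x)
  then show ?case by (intro exI[of _ "[:f x:]"]) auto
next
  case (snoc y xs)
  obtain p where p: "degree p \<le> sign_changes f xs"
    "\<And>k. k < length xs \<Longrightarrow> sgn (poly p (real k)) = f (xs ! k)"
    "\<And>t. real (length xs) \<le> t + 1 \<Longrightarrow> sgn (poly p t) = f (last xs)"
    using snoc.IH snoc.prems by auto
  show ?case
  proof (cases "f (last xs) = f y")
    case True
    show ?thesis
    proof (intro exI[of _ p] conjI allI impI)
      fix k assume "k < length (xs @ [y])"
      then show "sgn (poly p (real k)) = f ((xs @ [y]) ! k)"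
        using p(2)[of k] p(3)[of "real k"] True by (cases "k < length xs") (auto simp: nth_append)
    qed (use p True snoc in \<open>auto simp: sign_changes_snoc\<close>)
  next
    case False
    have "last xs \<in> set xs" using snoc.hyps by simp
    then have fy: "f y = - f (last xs)" using False snoc.prems by (metis in_set_conv_decomp
        append_is_Nil_conv last_in_set last_snoc minus_minus Un_iff set_append)
    \<comment> \<open>The new root lies halfway between the last old position
      \<open>length xs - 1\<close> and the new one. The factor is positive at all old positions and
      negative from the new one on.\<close>
    define q where "q = p * [:real (length xs) - 1 / 2, - 1:]"
    have q: "sgn (poly q t) = sgn (poly p t) * sgn (real (length xs) - 1 / 2 - t)" for t
    proof -
      have "poly q t = poly p t * (real (length xs) - 1 / 2 - t)" by (simp add: q_def algebra_simps)
      then show ?thesis by (simp add: sgn_mult)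
    qed
    show ?thesis
    proof (intro exI[of _ q] conjI allI impI)
      have "degree q \<le> degree p + 1" unfolding q_def
        by (rule order_trans[OF degree_mult_le]) simp
      then show "degree q \<le> sign_changes f (xs @ [y])"
        using p(1) False snoc.hyps by (simp add: sign_changes_snoc)
    next
      fix k assume k: "k < length (xs @ [y])"
      show "sgn (poly q (real k)) = f ((xs @ [y]) ! k)"
      proof (cases "k < length xs")
        case True
        then have "real k + 1 \<le> real (length xs)" by linarith
        then show ?thesis using p(2)[OF True] True by (simp add: q nth_append)
      next
        case False
        then have "k = length xs" using k by simp
        then show ?thesis using p(3)[of "real k"] fy by (simp add: q nth_append)
      qed
    next
      fix t assume t: "real (length (xs @ [y])) \<le> t + 1"
      then show "sgn (poly q t) = f (last (xs @ [y]))"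
        using p(3)[of t] fy by (simp add: q)
    qed
  qed
qed

text \<open>The walk covers every row but row 0. Polynomials of degree \<open>d\<close> give
  \<open>d + 1\<close> monomial terms, and row 0 is added by one more term of rank 1.\<close>

lemma sign_rank_le_sign_changes:
  assumes S: "S \<in> sign_matrices m n" and xs: "set xs = {1..<m}"
    and ch: "\<And>j. j < n \<Longrightarrow> sign_changes (\<lambda>i. S $$ (i, j)) xs \<le> d"
  shows "sign_rank S \<le> d + 2"
proof -
  note c = sign_matricesD[OF S]
  have "\<exists>p. degree p \<le> d \<and> (\<forall>k < length xs. sgn (poly p (real k)) = S $$ (xs ! k, j))" if "j < n" for j
  proof (cases "xs = []")
    case False
    show ?thesis
      using poly_with_sign_pattern[OF False, of "\<lambda>i. S $$ (i, j)"] c(2)[OF _ that] ch[OF that] xs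
      by (force dest: order_trans)
  qed (auto intro: exI[of _ 0])
  then obtain p where p: "\<And>j. j < n \<Longrightarrow> degree (p j) \<le> d"
    "\<And>j k. j < n \<Longrightarrow> k < length xs \<Longrightarrow> sgn (poly (p j) (real k)) = S $$ (xs ! k, j)"
    by metis
  have "\<exists>k < length xs. xs ! k = i" if "i \<in> {1..<m}" for i
    using that xs by (metis in_set_conv_nth)
  \<comment> \<open>A walk may visit a row several times; \<open>pos\<close> picks one
    visit.\<close>
  then obtain pos where pos: "\<And>i. i \<in> {1..<m} \<Longrightarrow> pos i < length xs \<and> xs ! pos i = i"
    by metis
  define M where "M = mat m n (\<lambda>(i, j). if i = 0 then S $$ (0, j) else poly (p j) (real (pos i)))"
  \<comment> \<open>Index \<open>Suc d\<close> carries row 0 alone; the indices up to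
    \<open>d\<close> carry the monomials, switched off in row 0.\<close>
  define f where "f k i = (if k = Suc d then if i = 0 then 1 else 0
    else if i = 0 then 0 else real (pos i) ^ k)" for k i
  define g where "g k j = (if k = Suc d then S $$ (0, j) else coeff (p j) k)" for k j
  have "sign_rank S \<le> vec_space.rank m M"
  proof (rule sign_rank_le[OF c(1)])
    show "M \<in> carrier_mat m n" by (simp add: M_def)
    fix i j assume ij: "i < m" "j < n"
    have "sgn (M $$ (i, j)) = S $$ (i, j)"
    proof (cases "i = 0")
      case True
      then show ?thesis using ij c(2)[of 0 j] by (auto simp: M_def)
    next
      case False
      then have "i \<in> {1..<m}" using ij by simp
      from pos[OF this] show ?thesis using p(2)[OF ij(2), of "pos i"] ij False by (simp add: M_def)
    qed
    then show "M $$ (i, j) \<noteq> 0 \<and> sgn (M $$ (i, j)) = S $$ (i, j)"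
      using c(2)[OF ij] by auto
  qed
  also have "\<dots> \<le> d + 2"
  proof (rule rank_le_sum_products[where n = n and f = f and g = g])
    show "M \<in> carrier_mat m n" by (simp add: M_def)
    fix i j assume ij: "i < m" "j < n"
    have "(\<Sum>k<d + 2. f k i * g k j) = (\<Sum>k\<le>d. f k i * g k j) + f (Suc d) i * g (Suc d) j"
      by (simp add: lessThan_Suc_atMost)
    also have "(\<Sum>k\<le>d. f k i * g k j) = (\<Sum>k\<le>d. if i = 0 then 0 else coeff (p j) k * real (pos i) ^ k)"
      by (intro sum.cong) (auto simp: f_def g_def)
    also have "\<dots> = (if i = 0 then 0 else poly (p j) (real (pos i)))"
      using p(1)[OF ij(2)] unfolding poly_altdef
      by (auto intro!: sum.mono_neutral_right coeff_eq_0)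
    finally show "M $$ (i, j) = (\<Sum>k<d + 2. f k i * g k j)"
      using ij by (simp add: M_def f_def g_def)
  qed
  finally show ?thesis .
qed

text \<open>Every surviving row \<open>a\<close> carries a closed walk \<open>L a\<close> around the tree of rows that were merged
  into it. Column \<open>j\<close> has weight \<open>v j + 1 = 2 ^ x j\<close>, where \<open>x j\<close> counts the tree edges across which
  column \<open>j\<close> changes sign; the walk crosses each of them twice.\<close>

definition merge_tree :: "real mat \<Rightarrow> nat \<Rightarrow> nat set \<Rightarrow> (nat \<Rightarrow> nat) \<Rightarrow> bool" where
  "merge_tree S n A v \<longleftrightarrow> (\<exists>L x. (\<forall>a\<in>A. L a \<noteq> [] \<and> hd (L a) = a) \<and> (\<Union>a\<in>A. set (L a)) = {1..<n} \<and>
     (\<forall>j<n. Suc (v j) = 2 ^ x j \<and> (\<Sum>a\<in>A. cyclic_changes (\<lambda>i. S $$ (i, j)) (L a)) \<le> 2 * x j))"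

text \<open>\<open>v j\<close> is the weight minus 1, so doubling the weight reads
  \<open>2 * (v j + 1) - 1\<close>.\<close>

definition double_weights :: "real mat \<Rightarrow> nat \<Rightarrow> nat \<Rightarrow> (nat \<Rightarrow> nat) \<Rightarrow> nat \<Rightarrow> nat" where
  "double_weights S a b v j = (if S $$ (a, j) = S $$ (b, j) then v j else Suc (2 * v j))"

definition sep_weight :: "real mat \<Rightarrow> nat \<Rightarrow> (nat \<Rightarrow> nat) \<Rightarrow> nat \<Rightarrow> nat \<Rightarrow> nat" where
  "sep_weight S n v a b = (\<Sum>j<n. if S $$ (a, j) = S $$ (b, j) then 0 else Suc (v j))"

lemma merge_tree_init: "merge_tree S n {1..<n} (\<lambda>_. 0)"
  unfolding merge_tree_def
  by (intro exI[of _ "\<lambda>a. [a]"] exI[of _ "\<lambda>_. 0"]) (auto simp: cyclic_changes_def)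

lemma merge_tree_step:
  assumes "merge_tree S n A v" "finite A" "a \<in> A" "b \<in> A" "a \<noteq> b"
  shows "merge_tree S n (A - {a}) (double_weights S a b v)"
proof -
  obtain L x where L: "\<And>a. a \<in> A \<Longrightarrow> L a \<noteq> [] \<and> hd (L a) = a" "(\<Union>a\<in>A. set (L a)) = {1..<n}"
    and x: "\<And>j. j < n \<Longrightarrow> Suc (v j) = 2 ^ x j"
      "\<And>j. j < n \<Longrightarrow> (\<Sum>a\<in>A. cyclic_changes (\<lambda>i. S $$ (i, j)) (L a)) \<le> 2 * x j"
    using assms(1)[unfolded merge_tree_def] by (elim exE conjE) metis
  \<comment> \<open>The walk of the discarded row \<open>a\<close> is put behind that of
    \<open>b\<close>, so that \<open>b\<close> stays at the head for later merges.\<close>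
  define L' where "L' = L(b := L b @ L a)"
  define x' where "x' j = x j + (if S $$ (a, j) = S $$ (b, j) then 0 else 1)" for j
  show ?thesis unfolding merge_tree_def
  proof (intro exI[of _ L'] exI[of _ x'] conjI allI impI ballI)
    fix c assume "c \<in> A - {a}"
    then show "L' c \<noteq> []" "hd (L' c) = c" using L(1) assms by (auto simp: L'_def)
  next
    have "(\<Union>a\<in>A - {a}. set (L' a)) = (\<Union>a\<in>A. set (L a))"
    proof (intro equalityI subsetI)
      fix y assume "y \<in> (\<Union>a\<in>A - {a}. set (L' a))"
      then show "y \<in> (\<Union>a\<in>A. set (L a))" using assms(3,4) by (auto simp: L'_def split: if_splits)
    next
      fix y assume "y \<in> (\<Union>a\<in>A. set (L a))"
      then obtain c where c: "c \<in> A" "y \<in> set (L c)" by blast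
      show "y \<in> (\<Union>a\<in>A - {a}. set (L' a))"
      proof (cases "c = a \<or> c = b")
        case True
        then have "y \<in> set (L' b)" using c by (auto simp: L'_def)
        then show ?thesis using assms(4,5) by blast
      next
        case False
        then have "y \<in> set (L' c)" "c \<in> A - {a}" using c by (auto simp: L'_def)
        then show ?thesis by blast
      qed
    qed
    then show "(\<Union>a\<in>A - {a}. set (L' a)) = {1..<n}" using L(2) by simp
  next
    fix j assume j: "j < n"
    show "Suc (double_weights S a b v j) = 2 ^ x' j"
      using x(1)[OF j] by (auto simp: double_weights_def x'_def)
    define c where "c xs = cyclic_changes (\<lambda>i. S $$ (i, j)) xs" for xs
    have "(\<Sum>i\<in>A - {a}. c (L' i)) = c (L b @ L a) + (\<Sum>i\<in>A - {a} - {b}. c (L' i))"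
      using assms by (subst sum.remove[of _ b]) (auto simp: L'_def)
    also have "(\<Sum>i\<in>A - {a} - {b}. c (L' i)) = (\<Sum>i\<in>A - {a} - {b}. c (L i))"
      by (intro sum.cong) (auto simp: L'_def)
    also have "c (L b @ L a) \<le> c (L b) + c (L a) + 2 * (if S $$ (a, j) = S $$ (b, j) then 0 else 1)"
      using cyclic_changes_append[of "L b" "L a" "\<lambda>i. S $$ (i, j)"] L(1)[of a] L(1)[of b] assms
      by (auto simp: c_def split: if_splits)
    finally have "(\<Sum>i\<in>A - {a}. c (L' i)) \<le> (c (L a) + (c (L b) + (\<Sum>i\<in>A - {a} - {b}. c (L i))))
        + 2 * (if S $$ (a, j) = S $$ (b, j) then 0 else 1)"
      by simp
    also have "c (L b) + (\<Sum>i\<in>A - {a} - {b}. c (L i)) = (\<Sum>i\<in>A - {a}. c (L i))"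
      using assms by (subst sum.remove[of "A - {a}" b]) auto
    also have "c (L a) + (\<Sum>i\<in>A - {a}. c (L i)) = (\<Sum>i\<in>A. c (L i))"
      using assms by (subst sum.remove[of A a]) auto
    finally show "(\<Sum>a\<in>A - {a}. cyclic_changes (\<lambda>i. S $$ (i, j)) (L' a)) \<le> 2 * x' j"
      using x(2)[OF j] unfolding c_def x'_def by (cases "S $$ (a, j) = S $$ (b, j)") simp_all
  qed
qed

lemma merge_tree_final:
  assumes S: "S \<in> sign_matrices n n" and T: "merge_tree S n {a} v"
    and l: "\<And>j. j < n \<Longrightarrow> Suc (v j) \<le> 2 ^ l"
  shows "sign_rank S \<le> 2 * l + 2"
proof -
  obtain L x where L: "set (L a) = {1..<n}"
    and x: "\<And>j. j < n \<Longrightarrow> Suc (v j) = 2 ^ x j"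
      "\<And>j. j < n \<Longrightarrow> cyclic_changes (\<lambda>i. S $$ (i, j)) (L a) \<le> 2 * x j"
    using T unfolding merge_tree_def by auto
  show ?thesis
  proof (rule sign_rank_le_sign_changes[OF S L])
    fix j assume j: "j < n"
    have "(2::nat) ^ x j \<le> 2 ^ l" using l[OF j] x(1)[OF j] by simp
    then have "x j \<le> l" by simp
    then show "sign_changes (\<lambda>i. S $$ (i, j)) (L a) \<le> 2 * l"
      using x(2)[OF j] sign_changes_le_cyclic[of "\<lambda>i. S $$ (i, j)" "L a"] by linarith
  qed
qed

section \<open>Growth of the total weight\<close>

text \<open>The factor \<open>n\<close> is the initial total weight. The round that starts with
  \<open>m\<close> rows contributes the factor for \<open>m\<close>; without row 0 the first round
  has \<open>m = n - 1\<close>.\<close>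

definition greedy_inv :: "real mat \<Rightarrow> nat \<Rightarrow> nat set \<Rightarrow> (nat \<Rightarrow> nat) \<Rightarrow> bool" where
  "greedy_inv S n A v \<longleftrightarrow> A \<subseteq> {1..<n} \<and> merge_tree S n A v \<and>
     real (\<Sum>j<n. Suc (v j)) \<le> real n * (\<Prod>m\<in>{card A<..<n}. 1 + close_frac (sign_rank S) m)"

lemma greedy_inv_init: "greedy_inv S n {1..<n} (\<lambda>_. 0)"
proof -
  have "{n - 1<..<n} = {}" by auto
  then show ?thesis using merge_tree_init[of S n] by (simp add: greedy_inv_def)
qed

lemma sum_double_weights:
  "(\<Sum>j<n. Suc (double_weights S a b v j)) = (\<Sum>j<n. Suc (v j)) + sep_weight S n v a b"
  unfolding sep_weight_def sum.distrib[symmetric]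
  by (intro sum.cong) (auto simp: double_weights_def)

text \<open>The least separating weight is at most that of the pair from
  \<open>exists_close_pair\<close>, applied with the current weights. Doubling adds exactly the
  separating weight to the total.\<close>

lemma greedy_inv_step:
  assumes S: "S \<in> sign_matrices n n" and inv: "greedy_inv S n A v"
    and ab: "a \<in> A" "b \<in> A" "a \<noteq> b"
    and min: "\<And>a' b'. a' \<in> A \<Longrightarrow> b' \<in> A \<Longrightarrow> a' \<noteq> b' \<Longrightarrow> sep_weight S n v a b \<le> sep_weight S n v a' b'"
  shows "greedy_inv S n (A - {a}) (double_weights S a b v)"
proof -
  have A: "A \<subseteq> {1..<n}" "merge_tree S n A v" "finite A"
    using inv finite_subset by (auto simp: greedy_inv_def)
  have "card {a, b} \<le> card A" using ab A(3) by (intro card_mono) auto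
  then have c2: "2 \<le> card A" using ab by simp
  have "card A \<le> card {1..<n}" using A(1) by (intro card_mono) auto
  then have cn: "card A < n" using c2 by simp
  have A': "A \<subseteq> {..<n}" using A(1) by auto
  define d where "d = sign_rank S"
  define W where "W = (\<Sum>j<n. Suc (v j))"
  define R where "R = (\<Prod>m\<in>{card A<..<n}. 1 + close_frac d m)"
  have cf: "0 \<le> close_frac d m" if "1 \<le> m" for m
    using that by (auto simp: close_frac_def)
  obtain a' b' where ab': "a' \<in> A" "b' \<in> A" "a' \<noteq> b'"
    "(\<Sum>j | j < n \<and> S $$ (a', j) \<noteq> S $$ (b', j). real (Suc (v j))) \<le> close_frac d (card A) * (\<Sum>j<n. real (Suc (v j)))"
    using exists_close_pair[OF S A' c2, of "\<lambda>j. real (Suc (v j))"] cn unfolding d_def by fastforce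
  have "real (sep_weight S n v a' b') = (\<Sum>j<n. if S $$ (a', j) \<noteq> S $$ (b', j) then real (Suc (v j)) else 0)"
    unfolding sep_weight_def of_nat_sum by (intro sum.cong) auto
  also have "\<dots> = (\<Sum>j\<in>{j\<in>{..<n}. S $$ (a', j) \<noteq> S $$ (b', j)}. real (Suc (v j)))"
    by (rule sum.inter_filter[symmetric]) simp
  also have "\<dots> \<le> close_frac d (card A) * real W"
    using ab'(4) by (simp add: W_def)
  finally have "real (sep_weight S n v a b) \<le> close_frac d (card A) * real W"
    using min[OF ab'(1-3)] by linarith
  then have "real (\<Sum>j<n. Suc (double_weights S a b v j)) \<le> (1 + close_frac d (card A)) * real W"
    unfolding sum_double_weights W_def[symmetric] by (simp add: algebra_simps)
  also have "\<dots> \<le> (1 + close_frac d (card A)) * (real n * R)"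
    using inv cf[of "card A"] c2 by (intro mult_left_mono) (auto simp: greedy_inv_def W_def R_def d_def)
  also have "\<dots> = real n * ((1 + close_frac d (card A)) * R)" by simp
  also have "(1 + close_frac d (card A)) * R = (\<Prod>m\<in>insert (card A) {card A<..<n}. 1 + close_frac d m)"
    unfolding R_def by (subst prod.insert) auto
  also have "insert (card A) {card A<..<n} = {card (A - {a})<..<n}"
    using A(3) ab c2 cn by auto
  finally show ?thesis
    using merge_tree_step[OF A(2,3) ab] A(1) by (auto simp: greedy_inv_def d_def)
qed

text \<open>Split at \<open>sqrt n\<close>. Below it each term is at most 1; above it
  \<open>ln m \<ge> ln n / 2\<close>, which turns the constant 12 into 24.\<close>

lemma sum_close_frac_le:
  assumes n: "2 \<le> n"
  shows "(\<Sum>m\<in>{1<..<n}. close_frac d m) \<le> sqrt (real n) + 24 * real d * (real n / ln (real n))"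
proof -
  define B where "B = {m \<in> {1<..<n}. real m \<le> sqrt (real n)}"
  have ln: "0 < ln (real n)" using n by simp
  have "close_frac d m \<le> (if real m \<le> sqrt (real n) then 1 else 0) + 24 * real d / ln (real n)"
    if m: "m \<in> {1<..<n}" for m
  proof (cases "real m \<le> sqrt (real n)")
    case True
    moreover have "close_frac d m \<le> 1" by (simp add: close_frac_def)
    moreover have "0 \<le> 24 * real d / ln (real n)" using ln by simp
    ultimately show ?thesis by simp
  next
    case False
    have "ln (real n) / 2 = ln (sqrt (real n))" using n by (simp add: ln_sqrt)
    also have "\<dots> \<le> ln (real m)" using False n m by (intro ln_mono) auto
    finally have "12 * real d / ln (real m) \<le> 12 * real d / (ln (real n) / 2)"
      using ln by (intro divide_left_mono) auto
    then show ?thesis using False by (simp add: close_frac_def)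
  qed
  then have "(\<Sum>m\<in>{1<..<n}. close_frac d m) \<le>
      (\<Sum>m\<in>{1<..<n}. (if real m \<le> sqrt (real n) then 1 else 0) + 24 * real d / ln (real n))"
    by (rule sum_mono)
  also have "\<dots> = real (card B) + real (card {1<..<n}) * (24 * real d / ln (real n))"
    by (simp add: sum.distrib B_def flip: sum.inter_filter)
  also have "\<dots> \<le> sqrt (real n) + real n * (24 * real d / ln (real n))"
  proof (intro add_mono mult_right_mono)
    have "B \<subseteq> {1..nat \<lfloor>sqrt (real n)\<rfloor>}" by (auto simp: B_def le_nat_floor)
    then have "card B \<le> nat \<lfloor>sqrt (real n)\<rfloor>" using card_mono[of "{1..nat \<lfloor>sqrt (real n)\<rfloor>}" B] by simp
    then have "real (card B) \<le> real (nat \<lfloor>sqrt (real n)\<rfloor>)" by (simp only: of_nat_le_iff)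
    also have "\<dots> \<le> sqrt (real n)" by (rule of_nat_floor) simp
    finally show "real (card B) \<le> sqrt (real n)" .
  qed (use ln in auto)
  finally show ?thesis by (simp add: mult.commute mult.left_commute)
qed

text \<open>The two conditions on \<open>l\<close> make it the binary logarithm of the total weight,
  rounded up. The case \<open>l = 0\<close> is separate because \<open>l - 1\<close> is
  truncated.\<close>

lemma greedy_inv_final:
  assumes S: "S \<in> sign_matrices n n" and n: "2 \<le> n" and inv: "greedy_inv S n A v" and A: "card A = 1"
    and W: "(\<Sum>j<n. Suc (v j)) \<le> 2 ^ l" "l = 0 \<or> 2 ^ (l - 1) < (\<Sum>j<n. Suc (v j))"
  shows "sign_rank S \<le> 2 * l + 2"
    and "real (2 * l + 2) \<le> 124 * (real n / ln (real n)) * real (sign_rank S)"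
proof -
  obtain a where a: "A = {a}" using A by (auto simp: card_1_singleton_iff)
  show "sign_rank S \<le> 2 * l + 2"
  proof (rule merge_tree_final[OF S])
    show "merge_tree S n {a} v" using inv a by (simp add: greedy_inv_def)
    fix j assume "j < n"
    then have "Suc (v j) \<le> (\<Sum>j<n. Suc (v j))" by (intro member_le_sum) auto
    then show "Suc (v j) \<le> 2 ^ l" using W(1) by simp
  qed
  define d where "d = sign_rank S"
  define q where "q = real n / ln (real n)"
  have ln: "0 < ln (real n)" using n by simp
  have q1: "1 \<le> q" using ln ln_bound[of "real n"] n by (simp add: q_def field_simps)
  have "ln (real n) = 2 * ln (sqrt (real n))" using n by (simp add: ln_sqrt)
  also have "\<dots> \<le> 2 * sqrt (real n)" using n ln_bound[of "sqrt (real n)"] by simp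
  finally have ln2: "ln (real n) \<le> 2 * sqrt (real n)" .
  then have "sqrt (real n) * ln (real n) \<le> sqrt (real n) * (2 * sqrt (real n))"
    by (intro mult_left_mono) auto
  also have "\<dots> = 2 * real n" by simp
  finally have sq: "sqrt (real n) \<le> 2 * q" using ln by (simp add: q_def field_simps)
  have d: "1 \<le> real d" using sign_rank_pos[OF S] n by (simp add: d_def)
  have dq: "q \<le> real d * q" using q1 mult_right_mono[OF d, of q] by simp
  have dq1: "1 \<le> real d * q" using q1 dq by linarith
  define w where "w = real (\<Sum>j<n. Suc (v j))"
  have "w \<le> real n * (\<Prod>m\<in>{1<..<n}. 1 + close_frac d m)"
    using inv A by (simp add: greedy_inv_def w_def d_def)
  also have "\<dots> \<le> real n * (\<Prod>m\<in>{1<..<n}. exp (close_frac d m))"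
    by (intro mult_left_mono prod_mono) (auto simp: close_frac_def)
  also have "\<dots> = exp (ln (real n) + (\<Sum>m\<in>{1<..<n}. close_frac d m))"
    using n by (simp add: exp_add exp_sum)
  also have "\<dots> \<le> exp (30 * (real d * q))"
  proof -
    have "(\<Sum>m\<in>{1<..<n}. close_frac d m) \<le> sqrt (real n) + 24 * (real d * q)"
      using sum_close_frac_le[OF n, of d] by (simp add: q_def mult.assoc)
    \<comment> \<open>\<open>30 = 4 + 2 + 24\<close>:
      \<open>ln n \<le> 2 * sqrt n \<le> 4 * q\<close>, then \<open>sqrt n \<le> 2 * q\<close>, then
      the bulk of the sum.\<close>
    then have "ln (real n) + (\<Sum>m\<in>{1<..<n}. close_frac d m) \<le> 30 * (real d * q)"
      using ln2 sq dq by linarith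
    then show ?thesis by simp
  qed
  finally have w: "w \<le> exp (30 * (real d * q))" .
  have "real l \<le> 60 * (real d * q) + 1"
  proof (cases "l = 0")
    case False
    then have "2 ^ (l - 1) < (\<Sum>j<n. Suc (v j))" using W(2) by simp
    then have "real (2 ^ (l - 1)) < w" unfolding w_def by (simp only: of_nat_less_iff)
    then have "2 ^ (l - 1) < exp (30 * (real d * q))" using w by simp
    then have "ln (2 ^ (l - 1)) < ln (exp (30 * (real d * q)))" by (subst ln_less_cancel_iff) auto
    then have "real (l - 1) * ln 2 < 30 * (real d * q)" by (simp add: ln_realpow)
    \<comment> \<open>Bounding \<open>ln 2\<close> below by \<open>1 / 2\<close> turns 30 into
      60.\<close>
    moreover have "1 / 2 \<le> ln (2::real)" using exp_half_le2 by (subst ln_ge_iff) simp_all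
    then have "real (l - 1) * (1 / 2) \<le> real (l - 1) * ln 2" by (intro mult_left_mono) auto
    ultimately show ?thesis using False by (simp add: of_nat_diff)
  qed (use dq1 in simp)
  \<comment> \<open>\<open>2 * (60 * d * q + 1) + 2\<close>, where the remaining 4 is absorbed by
    \<open>d * q \<ge> 1\<close>.\<close>
  then have "real (2 * l + 2) \<le> 124 * (real d * q)" using dq1 by simp
  then show "real (2 * l + 2) \<le> 124 * (real n / ln (real n)) * real (sign_rank S)"
    by (simp add: d_def q_def mult_ac)
qed

section \<open>Structured programs on the random access machine\<close>

fun straight :: "instr \<Rightarrow> bool" where
  "straight (Jump _) = False"
| "straight (Jump_Zero _ _) = False"
| "straight _ = True"

definition effect :: "instr \<Rightarrow> memory \<Rightarrow> memory" where
  "effect i m = snd (exec_instr i (0, m))"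

lemma effect_simps [simp]:
  "effect (Const i n) m = m(i := n)"
  "effect (Move i j) m = m(i := m j)"
  "effect (Add i j k) m = m(i := m j + m k)"
  "effect (Sub i j k) m = m(i := m j - m k)"
  "effect (Load i j) m = m(i := m (m j))"
  "effect (Store i j) m = m(m i := m j)"
  by (simp_all add: effect_def)

lemma exec_straight: "straight i \<Longrightarrow> exec_instr i (pc, m) = (Suc pc, effect i m)"
  by (cases i) auto

datatype prog = Block "instr list" | Seq prog prog | Cond nat prog prog | While nat prog

fun prog_size :: "prog \<Rightarrow> nat" where
  "prog_size (Block is) = length is"
| "prog_size (Seq p q) = prog_size p + prog_size q"
| "prog_size (Cond r p q) = prog_size p + prog_size q + 2"
| "prog_size (While r p) = prog_size p + 2"

text \<open>Jump targets are absolute, so the code depends on the address \<open>l\<close> at which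
  it is placed.\<close>

fun compile :: "nat \<Rightarrow> prog \<Rightarrow> instr list" where
  "compile l (Block is) = is"
| "compile l (Seq p q) = compile l p @ compile (l + prog_size p) q"
| "compile l (Cond r p q) = Jump_Zero r (l + prog_size p + 2) # compile (Suc l) p @
     Jump (l + prog_size p + prog_size q + 2) # compile (l + prog_size p + 2) q"
| "compile l (While r p) = Jump_Zero r (l + prog_size p + 2) # compile (Suc l) p @ [Jump l]"

lemma length_compile [simp]: "length (compile l p) = prog_size p"
  by (induction p arbitrary: l) auto

definition code_at :: "instr list \<Rightarrow> nat \<Rightarrow> instr list \<Rightarrow> bool" where
  "code_at P l is \<longleftrightarrow> (\<exists>us vs. P = us @ is @ vs \<and> length us = l)"

lemma code_at_append:
  "code_at P l (is @ js) \<longleftrightarrow> code_at P l is \<and> code_at P (l + length is) js"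
proof
  assume "code_at P l (is @ js)"
  then obtain us vs where "P = us @ (is @ js) @ vs" "length us = l" unfolding code_at_def by blast
  then show "code_at P l is \<and> code_at P (l + length is) js"
    unfolding code_at_def by (metis append.assoc length_append)
next
  assume "code_at P l is \<and> code_at P (l + length is) js"
  then obtain us vs us' vs' where *: "P = us @ is @ vs" "length us = l"
    "P = us' @ js @ vs'" "length us' = l + length is" unfolding code_at_def by blast
  then have "us' = us @ is" "js @ vs' = vs" 
    using append_eq_append_conv[of "us @ is" us' vs "js @ vs'"] by auto
  with * show "code_at P l (is @ js)" unfolding code_at_def by (metis append.assoc)
qed

lemma code_at_Cons:
  "code_at P l (i # is) \<longleftrightarrow> code_at P l [i] \<and> code_at P (Suc l) is"
  using code_at_append[of P l "[i]" "is"] by simp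

lemma step_code_at: "code_at P l [i] \<Longrightarrow> step P (l, m) = exec_instr i (l, m)"
  unfolding code_at_def step_def halted_def by auto

text \<open>A total-correctness triple with a time bound. Quantifying over the surrounding code and
  the address makes it compositional; a fragment ends by reaching the address just behind
  it.\<close>

definition runs :: "prog \<Rightarrow> memory \<Rightarrow> nat \<Rightarrow> (memory \<Rightarrow> bool) \<Rightarrow> bool" where
  "runs p m T Q \<longleftrightarrow> (\<forall>P l. code_at P l (compile l p) \<longrightarrow>
     (\<exists>t \<le> T. \<exists>m'. (step P ^^ t) (l, m) = (l + prog_size p, m') \<and> Q m'))"

lemma runs_mono:
  "runs p m T Q \<Longrightarrow> T \<le> T' \<Longrightarrow> (\<And>m'. Q m' \<Longrightarrow> Q' m') \<Longrightarrow> runs p m T' Q'"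
  unfolding runs_def by (meson order_trans)

lemma steps_block:
  "code_at P l is \<Longrightarrow> \<forall>i\<in>set is. straight i \<Longrightarrow>
    (step P ^^ length is) (l, m) = (l + length is, fold effect is m)"
proof (induction "is" arbitrary: l m)
  case (Cons i "is")
  have *: "code_at P l [i]" "code_at P (Suc l) is" using Cons.prems(1) by (auto simp: code_at_Cons[of _ _ i "is"])
  have "(step P ^^ length (i # is)) (l, m) = (step P ^^ length is) (step P (l, m))"
    by (simp add: funpow_swap1)
  also have "step P (l, m) = (Suc l, effect i m)"
    using step_code_at[OF *(1)] Cons.prems(2) by (simp add: exec_straight)
  finally show ?case using Cons.IH[OF *(2)] Cons.prems(2) by simp
qed simp

lemma runs_Block:
  assumes "\<forall>i\<in>set is. straight i" "length is \<le> T" "Q (fold effect is m)"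
  shows "runs (Block is) m T Q"
  unfolding runs_def
proof (intro allI impI)
  fix P l assume "code_at P l (compile l (Block is))"
  then have "(step P ^^ length is) (l, m) = (l + length is, fold effect is m)"
    using steps_block assms(1) by simp
  then show "\<exists>t\<le>T. \<exists>m'. (step P ^^ t) (l, m) = (l + prog_size (Block is), m') \<and> Q m'"
    using assms(2,3) by auto
qed

lemma funpow_comp_eq: "(f ^^ s) x = y \<Longrightarrow> (f ^^ t) y = z \<Longrightarrow> (f ^^ (t + s)) x = z"
  by (simp add: funpow_add)

lemma runs_Seq:
  assumes "runs p m T1 (\<lambda>m'. runs q m' T2 Q)"
  shows "runs (Seq p q) m (T1 + T2) Q"
  unfolding runs_def
proof (intro allI impI)
  fix P l assume "code_at P l (compile l (Seq p q))"
  then have c: "code_at P l (compile l p)" "code_at P (l + prog_size p) (compile (l + prog_size p) q)"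
    by (simp_all add: code_at_append)
  from assms c(1) obtain t1 m1 where 1: "t1 \<le> T1" "(step P ^^ t1) (l, m) = (l + prog_size p, m1)"
    "runs q m1 T2 Q" unfolding runs_def[of p] by blast
  from 1(3) c(2) obtain t2 m2 where 2: "t2 \<le> T2"
    "(step P ^^ t2) (l + prog_size p, m1) = (l + prog_size p + prog_size q, m2)" "Q m2"
    unfolding runs_def[of q] by blast
  show "\<exists>t\<le>T1 + T2. \<exists>m'. (step P ^^ t) (l, m) = (l + prog_size (Seq p q), m') \<and> Q m'"
    using funpow_comp_eq[OF 1(2) 2(2)] 1(1) 2(1,3)
    by (intro exI[of _ "t2 + t1"] conjI exI[of _ m2]) auto
qed

text \<open>The 2 pays for the test and for the jump over the second branch.\<close>

lemma runs_Cond: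
  assumes "m r \<noteq> 0 \<Longrightarrow> runs p m T Q" "m r = 0 \<Longrightarrow> runs q m T Q"
  shows "runs (Cond r p q) m (T + 2) Q"
  unfolding runs_def
proof (intro allI impI)
  fix P l assume c0: "code_at P l (compile l (Cond r p q))"
  let ?lq = "l + prog_size p + 2"
  have c: "code_at P l [Jump_Zero r ?lq]" "code_at P (Suc l) (compile (Suc l) p)"
    "code_at P (Suc l + prog_size p) [Jump (l + prog_size p + prog_size q + 2)]"
    "code_at P ?lq (compile ?lq q)"
  proof -
    have "code_at P l ([Jump_Zero r ?lq] @ compile (Suc l) p @
        [Jump (l + prog_size p + prog_size q + 2)] @ compile ?lq q)"
      using c0 by simp
    note this[unfolded code_at_append]
    then show "code_at P l [Jump_Zero r ?lq]" "code_at P (Suc l) (compile (Suc l) p)"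
      "code_at P (Suc l + prog_size p) [Jump (l + prog_size p + prog_size q + 2)]"
      "code_at P ?lq (compile ?lq q)"
      by simp_all
  qed
  show "\<exists>t\<le>T + 2. \<exists>m'. (step P ^^ t) (l, m) = (l + prog_size (Cond r p q), m') \<and> Q m'"
  proof (cases "m r = 0")
    case True
    have s: "(step P ^^ 1) (l, m) = (?lq, m)" using step_code_at[OF c(1)] True by simp
    from assms(2)[OF True] c(4) obtain t m' where t: "t \<le> T"
      "(step P ^^ t) (?lq, m) = (?lq + prog_size q, m')" "Q m'" unfolding runs_def by blast
    from funpow_comp_eq[OF s t(2)] show ?thesis using t(1,3)
      by (intro exI[of _ "t + 1"] conjI exI[of _ m']) (auto simp del: funpow.simps)
  next
    case False
    have s: "(step P ^^ 1) (l, m) = (Suc l, m)" using step_code_at[OF c(1)] False by simp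
    from assms(1)[OF False] c(2) obtain t m' where t: "t \<le> T"
      "(step P ^^ t) (Suc l, m) = (Suc l + prog_size p, m')" "Q m'" unfolding runs_def by blast
    have e: "(step P ^^ 1) (Suc l + prog_size p, m') = (l + prog_size p + prog_size q + 2, m')"
      using step_code_at[OF c(3)] by simp
    from funpow_comp_eq[OF funpow_comp_eq[OF s t(2)] e] show ?thesis using t(1,3)
      by (intro exI[of _ "1 + (t + 1)"] conjI exI[of _ m']) (auto simp del: funpow.simps)
  qed
qed

text \<open>The index of \<open>I\<close> is the number of remaining iterations, hence both variant
  and time bound: test, body and jump back each time, plus one last test.\<close>

lemma runs_While:
  assumes "I n m" and reg: "\<And>k m. I k m \<Longrightarrow> m r = 0 \<longleftrightarrow> k = 0"
    and body: "\<And>k m. I (Suc k) m \<Longrightarrow> runs p m T (I k)"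
  shows "runs (While r p) m (n * (T + 2) + 1) (I 0)"
  unfolding runs_def
proof (intro allI impI)
  fix P l assume c0: "code_at P l (compile l (While r p))"
  let ?e = "l + prog_size p + 2"
  have c: "code_at P l [Jump_Zero r ?e]" "code_at P (Suc l) (compile (Suc l) p)"
    "code_at P (Suc l + prog_size p) [Jump l]"
  proof -
    have "code_at P l ([Jump_Zero r ?e] @ compile (Suc l) p @ [Jump l])" using c0 by simp
    note this[unfolded code_at_append]
    then show "code_at P l [Jump_Zero r ?e]" "code_at P (Suc l) (compile (Suc l) p)"
      "code_at P (Suc l + prog_size p) [Jump l]"
      by simp_all
  qed
  have "\<exists>t\<le>n * (T + 2) + 1. \<exists>m'. (step P ^^ t) (l, m) = (?e, m') \<and> I 0 m'"
    using \<open>I n m\<close>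
  proof (induction n arbitrary: m)
    case 0
    then have "m r = 0" using reg by blast
    then have "(step P ^^ 1) (l, m) = (?e, m)" using step_code_at[OF c(1)] by simp
    then show ?case using 0 by (intro exI[of _ 1]) auto
  next
    case (Suc n)
    have "m r \<noteq> 0" using reg[OF Suc.prems] by simp
    then have s: "(step P ^^ 1) (l, m) = (Suc l, m)" using step_code_at[OF c(1)] by simp
    from body[OF Suc.prems] c(2) obtain t m' where t: "t \<le> T"
      "(step P ^^ t) (Suc l, m) = (Suc l + prog_size p, m')" "I n m'" unfolding runs_def by blast
    have e: "(step P ^^ 1) (Suc l + prog_size p, m') = (l, m')"
      using step_code_at[OF c(3)] by simp
    from Suc.IH[OF t(3)] obtain t' m'' where t': "t' \<le> n * (T + 2) + 1"
      "(step P ^^ t') (l, m') = (?e, m'')" "I 0 m''" by blast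
    from funpow_comp_eq[OF funpow_comp_eq[OF funpow_comp_eq[OF s t(2)] e] t'(2)]
    show ?case using t(1) t'(1,3)
      by (intro exI[of _ "t' + (1 + (t + 1))"] conjI exI[of _ m'']) (auto simp del: funpow.simps)
  qed
  then show "\<exists>t\<le>n * (T + 2) + 1. \<exists>m'. (step P ^^ t) (l, m) = (l + prog_size (While r p), m') \<and> I 0 m'"
    by simp
qed

lemma runs_compile:
  assumes "runs p m T Q"
  shows "\<exists>t \<le> T. let c = (step (compile 0 p) ^^ t) (0, m) in halted (compile 0 p) c \<and> Q (snd c)"
proof -
  have "code_at (compile 0 p) 0 (compile 0 p)" unfolding code_at_def by auto
  with assms obtain t m' where "t \<le> T" "(step (compile 0 p) ^^ t) (0, m) = (0 + prog_size p, m')" "Q m'"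
    unfolding runs_def by blast
  then show ?thesis by (intro exI[of _ t]) (auto simp: halted_def)
qed

lemma runs_SeqI:
  assumes "runs p m T1 (\<lambda>m'. runs q m' T2 Q)" "T1 + T2 \<le> T"
  shows "runs (Seq p q) m T Q"
  by (rule runs_mono[OF runs_Seq[OF assms(1)] assms(2)])

lemma runs_Block_Seq:
  assumes "\<forall>i\<in>set is. straight i" "runs q (fold effect is m) T2 Q" "length is + T2 \<le> T"
  shows "runs (Seq (Block is) q) m T Q"
proof (rule runs_SeqI[where ?T1.0 = "length is" and ?T2.0 = T2])
  show "runs (Block is) m (length is) (\<lambda>m'. runs q m' T2 Q)"
    by (rule runs_Block) (use assms in simp_all)
qed (rule assms(3))

lemma runs_CondI:
  assumes "m r \<noteq> 0 \<Longrightarrow> runs p m T' Q" "m r = 0 \<Longrightarrow> runs q m T' Q" "T' + 2 \<le> T"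
  shows "runs (Cond r p q) m T Q"
  by (rule runs_mono[OF runs_Cond assms(3)]) (use assms(1,2) in simp_all)

section \<open>The algorithm\<close>

text \<open>
  Registers 0 to 27 serve as scratch space. They overlap the input, but if the order \<open>N\<close> is at least 30
  they only destroy part of row 0, which the algorithm ignores: dropping a row changes the sign rank by
  at most 1. Register 0 keeps \<open>N\<close>, register 1 the constant 1, and register 10 the total weight.

  Above the input lie the column weights (decreased by 1) and a flag per row that is nonzero once
  the row is removed, so the initial zeros encode weight 1 and "all rows present".
\<close>

definition row_addr :: "nat \<Rightarrow> nat \<Rightarrow> nat" where "row_addr N i = Suc (i * N)"
definition weight_base :: "nat \<Rightarrow> nat" where "weight_base N = Suc (N * N)"
definition flag_base :: "nat \<Rightarrow> nat" where "flag_base N = Suc (N * N + N)"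

text \<open>For \<open>N \<ge> 30\<close> the rows from 1 on thus lie above the scratch registers
  and below the weights.\<close>

lemma row_addr_bounds:
  assumes "1 \<le> i"
  shows "N < row_addr N i" "i < N \<Longrightarrow> j < N \<Longrightarrow> row_addr N i + j < weight_base N"
proof -
  show "N < row_addr N i" using assms by (simp add: row_addr_def less_Suc_eq_le)
  assume "i < N" "j < N"
  then have "Suc i * N \<le> N * N" by (intro mult_le_mono1) simp
  then show "row_addr N i + j < weight_base N"
    using \<open>j < N\<close> by (simp add: row_addr_def weight_base_def)
qed

section \<open>Comparing two rows column by column\<close>

definition mem_sep :: "nat \<Rightarrow> memory \<Rightarrow> nat \<Rightarrow> nat \<Rightarrow> nat \<Rightarrow> nat" where
  "mem_sep N M a b n = (\<Sum>j<n. if M (row_addr N a + j) = M (row_addr N b + j) then 0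
     else Suc (M (weight_base N + j)))"

text \<open>Register 27 receives the sum of both truncated differences, which is nonzero exactly if
  the entries differ. Registers 22 to 24 walk along the weights and the two rows. Cost evaluation
  and weight update share this loop.\<close>

definition column_loop :: "prog \<Rightarrow> prog" where
  "column_loop p = While 21
    (Seq (Block [Load 25 23, Load 26 24, Sub 27 25 26, Sub 25 26 25, Add 27 27 25])
    (Seq (Cond 27 p (Block []))
      (Block [Add 23 23 1, Add 24 24 1, Add 22 22 1, Sub 21 21 1])))"

definition cost_prog :: prog where
  "cost_prog = Seq (Block [Move 21 0, Move 22 4, Move 23 15, Move 24 18, Const 20 0])
    (column_loop (Block [Load 25 22, Add 20 20 25, Add 20 20 1]))"

definition update_prog :: prog where
  "update_prog = Seq (Block [Move 21 0, Move 22 4, Move 23 11, Move 24 12])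
    (column_loop (Block [Load 25 22, Add 25 25 25, Add 25 25 1, Store 22 25]))"

lemma runs_cost:
  assumes N: "30 \<le> N" and m: "m 0 = N" "m 1 = 1" "m 4 = weight_base N"
    "m 15 = row_addr N a" "m 18 = row_addr N b" and ab: "1 \<le> a" "1 \<le> b"
  shows "runs cost_prog m (17 * N)
    (\<lambda>m'. m' 20 = mem_sep N m a b N \<and> (\<forall>x. x < 20 \<or> 27 < x \<longrightarrow> m' x = m x))"
proof -
  define I where "I k m' \<longleftrightarrow> (\<exists>n. n + k = N \<and> m' 21 = k \<and> m' 22 = weight_base N + n \<and>
    m' 23 = row_addr N a + n \<and> m' 24 = row_addr N b + n \<and> m' 20 = mem_sep N m a b n \<and>
    (\<forall>x. x < 20 \<or> 27 < x \<longrightarrow> m' x = m x))" for k m'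
  have addr: "30 < row_addr N a" "30 < row_addr N b" "30 < weight_base N"
    using row_addr_bounds(1)[OF ab(1), of N] row_addr_bounds(1)[OF ab(2), of N] N
      mult_le_mono[OF N N] by (auto simp: weight_base_def)
  \<comment> \<open>14 is 5 for the comparison, 3 + 2 for the conditional and 4 for advancing; the
    loop adds 2 per column.\<close>
  have body: "runs (Seq (Block [Load 25 23, Load 26 24, Sub 27 25 26, Sub 25 26 25, Add 27 27 25])
      (Seq (Cond 27 (Block [Load 25 22, Add 20 20 25, Add 20 20 1]) (Block []))
      (Block [Add 23 23 1, Add 24 24 1, Add 22 22 1, Sub 21 21 1]))) m' 14 (I k)"
    if Isuc: "I (Suc k) m'" for k m'
  proof -
    obtain n where n: "n + Suc k = N" and r: "m' 21 = Suc k" "m' 22 = weight_base N + n"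
      "m' 23 = row_addr N a + n" "m' 24 = row_addr N b + n" "m' 20 = mem_sep N m a b n"
      and fr: "\<forall>x. x < 20 \<or> 27 < x \<longrightarrow> m' x = m x"
      using Isuc unfolding I_def by blast
    have f: "m' (Suc 0) = 1" "m' (row_addr N a + n) = m (row_addr N a + n)"
      "m' (row_addr N b + n) = m (row_addr N b + n)" "m' (weight_base N + n) = m (weight_base N + n)"
      using fr addr m by auto
    show ?thesis
      apply (rule runs_Block_Seq[where ?T2.0 = 9], (simp; fail))
       apply (rule runs_SeqI[where ?T1.0 = 5 and ?T2.0 = 4])
        apply (rule runs_CondI[where T' = 3])
          apply (rule runs_Block, (simp; fail), (simp; fail))+
          apply (unfold I_def, rule exI[of _ "Suc n"])
          apply (use r f n fr addr in \<open>auto simp: mem_sep_def\<close>)[1]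
         apply (rule runs_Block, (simp; fail), (simp; fail))+
         apply (rule exI[of _ "Suc n"])
         apply (use r f n fr addr in \<open>auto simp: mem_sep_def\<close>)[1]
        apply simp_all
      done
  qed
  have "runs (column_loop (Block [Load 25 22, Add 20 20 25, Add 20 20 1]))
     (fold effect [Move 21 0, Move 22 4, Move 23 15, Move 24 18, Const 20 0] m)
     (N * (14 + 2) + 1) (I 0)"
    unfolding column_loop_def
  proof (rule runs_While[where I = I])
    show "I N (fold effect [Move 21 0, Move 22 4, Move 23 15, Move 24 18, Const 20 0] m)"
      using m unfolding I_def by (intro exI[of _ 0]) (auto simp: mem_sep_def)
    show "m' 21 = 0 \<longleftrightarrow> k = 0" if "I k m'" for k m' using that unfolding I_def by auto
  qed (rule body)
  then have "runs (column_loop (Block [Load 25 22, Add 20 20 25, Add 20 20 1]))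
     (fold effect [Move 21 0, Move 22 4, Move 23 15, Move 24 18, Const 20 0] m)
     (N * (14 + 2) + 1)
     (\<lambda>m'. m' 20 = mem_sep N m a b N \<and> (\<forall>x. x < 20 \<or> 27 < x \<longrightarrow> m' x = m x))"
    by (rule runs_mono) (auto simp: I_def)
  then show ?thesis unfolding cost_prog_def
    by (rule runs_Block_Seq[rotated]) (use N in auto)
qed

lemma runs_update:
  assumes N: "30 \<le> N" and m: "m 0 = N" "m 1 = 1" "m 4 = weight_base N"
    "m 11 = row_addr N a" "m 12 = row_addr N b" and ab: "1 \<le> a" "a < N" "1 \<le> b" "b < N"
  shows "runs update_prog m (18 * N)
    (\<lambda>m'. (\<forall>j<N. m' (weight_base N + j) = (if m (row_addr N a + j) = m (row_addr N b + j)
        then m (weight_base N + j) else Suc (2 * m (weight_base N + j)))) \<and>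
      (\<forall>x. (x < 20 \<or> 27 < x) \<and> (x < weight_base N \<or> weight_base N + N \<le> x) \<longrightarrow> m' x = m x))"
proof -
  define new where "new j = (if m (row_addr N a + j) = m (row_addr N b + j)
        then m (weight_base N + j) else Suc (2 * m (weight_base N + j)))" for j
  define I where "I k m' \<longleftrightarrow> (\<exists>n. n + k = N \<and> m' 21 = k \<and> m' 22 = weight_base N + n \<and>
    m' 23 = row_addr N a + n \<and> m' 24 = row_addr N b + n \<and> (\<forall>j<n. m' (weight_base N + j) = new j) \<and>
    (\<forall>x. (x < 20 \<or> 27 < x) \<and> (x < weight_base N \<or> weight_base N + n \<le> x) \<longrightarrow> m' x = m x))" for k m'
  have addr: "30 < row_addr N a" "30 < row_addr N b" "30 < weight_base N"
    using row_addr_bounds(1)[OF ab(1), of N] row_addr_bounds(1)[OF ab(3), of N] N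
      mult_le_mono[OF N N] by (auto simp: weight_base_def)
  have body: "runs (Seq (Block [Load 25 23, Load 26 24, Sub 27 25 26, Sub 25 26 25, Add 27 27 25])
      (Seq (Cond 27 (Block [Load 25 22, Add 25 25 25, Add 25 25 1, Store 22 25]) (Block []))
      (Block [Add 23 23 1, Add 24 24 1, Add 22 22 1, Sub 21 21 1]))) m' 15 (I k)"
    if Isuc: "I (Suc k) m'" for k m'
  proof -
    obtain n where n: "n + Suc k = N" and r: "m' 21 = Suc k" "m' 22 = weight_base N + n"
      "m' 23 = row_addr N a + n" "m' 24 = row_addr N b + n"
      and upd: "\<forall>j<n. m' (weight_base N + j) = new j"
      and fr: "\<forall>x. (x < 20 \<or> 27 < x) \<and> (x < weight_base N \<or> weight_base N + n \<le> x) \<longrightarrow> m' x = m x"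
      using Isuc unfolding I_def by blast
    \<comment> \<open>The rows lie below the weights, so the updates never touch entries still to be
      compared.\<close>
    have "row_addr N a + n < weight_base N" "row_addr N b + n < weight_base N"
      using row_addr_bounds(2) ab n by auto
    then have f: "m' (Suc 0) = 1" "m' (row_addr N a + n) = m (row_addr N a + n)"
      "m' (row_addr N b + n) = m (row_addr N b + n)" "m' (weight_base N + n) = m (weight_base N + n)"
      using fr addr m by auto
    have fin: "I k m3" if m3: "m3 21 = k" "m3 22 = weight_base N + Suc n" "m3 23 = row_addr N a + Suc n"
        "m3 24 = row_addr N b + Suc n" "m3 (weight_base N + n) = new n"
        "\<forall>x. (x < 20 \<or> 27 < x) \<and> x \<noteq> weight_base N + n \<longrightarrow> m3 x = m' x" for m3
      unfolding I_def
    proof (intro exI[of _ "Suc n"] conjI allI impI)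
      fix j assume "j < Suc n"
      then show "m3 (weight_base N + j) = new j"
        using m3(5,6) upd addr(3) by (cases "j = n") auto
    next
      fix x assume "(x < 20 \<or> 27 < x) \<and> (x < weight_base N \<or> weight_base N + Suc n \<le> x)"
      then show "m3 x = m x" using m3(6) fr by auto
    qed (use m3 n in auto)
    show ?thesis
      apply (rule runs_Block_Seq[where ?T2.0 = 10], (simp; fail))
       apply (rule runs_SeqI[where ?T1.0 = 6 and ?T2.0 = 4])
        apply (rule runs_CondI[where T' = 4])
          apply (rule runs_Block, (simp; fail), (simp; fail))+
          apply (rule fin; use r f addr in \<open>auto simp: new_def\<close>)
         apply (rule runs_Block, (simp; fail), (simp; fail))+
         apply (rule fin; use r f addr in \<open>auto simp: new_def\<close>)
        apply simp_all
      done
  qed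
  have "runs (column_loop (Block [Load 25 22, Add 25 25 25, Add 25 25 1, Store 22 25]))
     (fold effect [Move 21 0, Move 22 4, Move 23 11, Move 24 12] m)
     (N * (15 + 2) + 1) (I 0)"
    unfolding column_loop_def
  proof (rule runs_While[where I = I])
    show "I N (fold effect [Move 21 0, Move 22 4, Move 23 11, Move 24 12] m)"
      using m unfolding I_def by (intro exI[of _ 0]) auto
    show "m' 21 = 0 \<longleftrightarrow> k = 0" if "I k m'" for k m' using that unfolding I_def by auto
  qed (rule body)
  then have "runs (column_loop (Block [Load 25 22, Add 25 25 25, Add 25 25 1, Store 22 25]))
     (fold effect [Move 21 0, Move 22 4, Move 23 11, Move 24 12] m)
     (N * (15 + 2) + 1)
     (\<lambda>m'. (\<forall>j<N. m' (weight_base N + j) = new j) \<and>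
      (\<forall>x. (x < 20 \<or> 27 < x) \<and> (x < weight_base N \<or> weight_base N + N \<le> x) \<longrightarrow> m' x = m x))"
    by (rule runs_mono) (auto simp: I_def)
  then have "runs update_prog m (18 * N)
     (\<lambda>m'. (\<forall>j<N. m' (weight_base N + j) = new j) \<and>
      (\<forall>x. (x < 20 \<or> 27 < x) \<and> (x < weight_base N \<or> weight_base N + N \<le> x) \<longrightarrow> m' x = m x))"
    unfolding update_prog_def
    by (rule runs_Block_Seq[rotated]) (use N in auto)
  then show ?thesis by (simp add: new_def)
qed

section \<open>Searching for a cheapest pair\<close>

text \<open>\<open>E\<close> is the set of pairs examined so far and \<open>W\<close> the total
  weight. \<open>Suc W\<close> is a sentinel above every possible cost, so the first pair examined
  replaces it.\<close>

definition best_pair :: "nat \<Rightarrow> memory \<Rightarrow> nat \<Rightarrow> (nat \<times> nat) set \<Rightarrow> memory \<Rightarrow> bool" where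
  "best_pair N M W E m \<longleftrightarrow>
    (m 9 = Suc W \<or> (\<exists>a b. (a, b) \<in> E \<and> m 9 = mem_sep N M a b N \<and> m 11 = row_addr N a \<and>
       m 12 = row_addr N b \<and> m 13 = flag_base N + a)) \<and>
    (\<forall>a b. (a, b) \<in> E \<longrightarrow> m 9 \<le> mem_sep N M a b N)"

lemma best_pair_cong:
  "m' 9 = m 9 \<Longrightarrow> m' 11 = m 11 \<Longrightarrow> m' 12 = m 12 \<Longrightarrow> m' 13 = m 13 \<Longrightarrow>
    best_pair N M W E m \<Longrightarrow> best_pair N M W E m'"
  unfolding best_pair_def by simp

lemma best_pair_keep:
  "best_pair N M W E m \<Longrightarrow> m 9 \<le> mem_sep N M a b N \<Longrightarrow> best_pair N M W (insert (a, b) E) m"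
  unfolding best_pair_def by blast

lemma best_pair_replace:
  "best_pair N M W E m \<Longrightarrow> mem_sep N M a b N < m 9 \<Longrightarrow> m' 9 = mem_sep N M a b N \<Longrightarrow>
    m' 11 = row_addr N a \<Longrightarrow> m' 12 = row_addr N b \<Longrightarrow> m' 13 = flag_base N + a \<Longrightarrow>
    best_pair N M W (insert (a, b) E) m'"
  unfolding best_pair_def by fastforce

lemma mem_sep_cong:
  assumes "30 \<le> N" "1 \<le> a" "1 \<le> b" "\<And>x. 27 < x \<Longrightarrow> m x = M x"
  shows "mem_sep N m a b n = mem_sep N M a b n"
proof -
  have "27 < row_addr N a" "27 < row_addr N b" "27 < weight_base N"
    using row_addr_bounds(1)[OF assms(2), of N] row_addr_bounds(1)[OF assms(3), of N] assms(1)
      mult_le_mono[OF assms(1,1)] by (auto simp: weight_base_def)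
  then show ?thesis unfolding mem_sep_def by (intro sum.cong refl) (simp add: assms(4))
qed

text \<open>The flag in register 25 skips removed rows. The truncated difference in register 26 is
  nonzero exactly if the candidate pair is strictly cheaper than the best one.\<close>

definition partner_body :: prog where
  "partner_body = Seq (Block [Load 25 19])
    (Seq (Cond 25 (Block [])
       (Seq cost_prog (Seq (Block [Sub 26 9 20])
         (Cond 26 (Block [Move 9 20, Move 11 15, Move 12 18, Move 13 16]) (Block [])))))
     (Block [Add 18 18 0, Add 19 19 1, Sub 17 17 1]))"

text \<open>Register 16 minus register 6 is \<open>a\<close>, so register 17 starts at
  \<open>a - 1\<close>, the number of rows \<open>b\<close> with \<open>1 \<le> b < a\<close>. By
  symmetry larger \<open>b\<close> need no visit.\<close>

definition partner_loop :: prog where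
  "partner_loop = Seq (Block [Sub 17 16 6, Sub 17 17 1, Add 18 0 1, Add 19 6 1]) (While 17 partner_body)"

definition partners :: "nat \<Rightarrow> memory \<Rightarrow> nat \<Rightarrow> nat set" where
  "partners N M n = {b. 1 \<le> b \<and> b < n \<and> M (flag_base N + b) = 0}"

lemma partners_Suc:
  "1 \<le> n \<Longrightarrow> partners N M (Suc n) =
    (if M (flag_base N + n) = 0 then insert n (partners N M n) else partners N M n)"
  by (auto simp: partners_def less_Suc_eq)

lemma runs_partner_body:
  assumes N: "30 \<le> N" and m: "m 0 = N" "m 1 = 1" "m 4 = weight_base N" "m 15 = row_addr N a"
    "m 16 = flag_base N + a" "m 17 = Suc k" "m 18 = row_addr N b" "m 19 = flag_base N + b"
    and ab: "1 \<le> a" "1 \<le> b" and M: "\<And>x. 27 < x \<Longrightarrow> m x = M x"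
    and best: "best_pair N M W (E \<union> Pair a ` partners N M b) m"
  shows "runs partner_body m (18 * N) (\<lambda>m'. m' 17 = k \<and> m' 18 = row_addr N (Suc b) \<and>
    m' 19 = flag_base N + Suc b \<and> best_pair N M W (E \<union> Pair a ` partners N M (Suc b)) m' \<and>
    (\<forall>x. x \<notin> {9, 11, 12, 13} \<and> (x < 17 \<or> 27 < x) \<longrightarrow> m' x = m x))"
    (is "runs _ _ _ ?Q")
proof -
  let ?E = "E \<union> Pair a ` partners N M (Suc b)"
  let ?adv = "[Add 18 18 0, Add 19 19 1, Sub 17 17 1]"
  have flag: "m (flag_base N + b) = M (flag_base N + b)" using N by (intro M) (simp add: flag_base_def)
  \<comment> \<open>The three cases (row removed, pair not cheaper, pair cheaper) end in the same
    address update, verified here once for all.\<close>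
  have adv: "runs (Block ?adv) m2 3 ?Q"
    if m2: "\<forall>x. x \<notin> {9, 11, 12, 13} \<and> (x < 20 \<or> 27 < x) \<longrightarrow> m2 x = m x" "best_pair N M W ?E m2" for m2
  proof (rule runs_Block)
    have m2': "m2 0 = N" "m2 (Suc 0) = 1" "m2 17 = Suc k" "m2 18 = row_addr N b" "m2 19 = flag_base N + b"
      using m2(1) m by auto
    have "best_pair N M W ?E (fold effect ?adv m2)"
      by (rule best_pair_cong[OF _ _ _ _ m2(2)]) simp_all
    then show "?Q (fold effect ?adv m2)" using m2(1) m2' by (auto simp: row_addr_def)
  qed simp_all
  define m1 where "m1 = fold effect [Load 25 19] m"
  have m1: "m1 25 = M (flag_base N + b)" "\<forall>x. x \<noteq> 25 \<longrightarrow> m1 x = m x"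
    using m flag by (simp_all add: m1_def)
  show ?thesis unfolding partner_body_def
  proof (rule runs_Block_Seq[where ?T2.0 = "17 * N + 12"], simp, fold m1_def,
      rule runs_SeqI[where ?T1.0 = "17 * N + 9" and ?T2.0 = 3], rule runs_CondI[where T' = "17 * N + 7"])
    assume "m1 25 \<noteq> 0"
    then have "?E = E \<union> Pair a ` partners N M b" using ab(2) m1(1) by (simp add: partners_Suc)
    then have "best_pair N M W ?E m1" using best_pair_cong[OF _ _ _ _ best, of m1] m1(2) by simp
    then show "runs (Block []) m1 (17 * N + 7) (\<lambda>m'. runs (Block ?adv) m' 3 ?Q)"
      using m1(2) by (intro runs_Block adv) auto
  next
    assume "m1 25 = 0"
    then have E: "?E = insert (a, b) (E \<union> Pair a ` partners N M b)"
      using ab(2) m1(1) by (simp add: partners_Suc)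
    let ?upd = "[Move 9 20, Move 11 15, Move 12 18, Move 13 16]"
    have sep: "mem_sep N m1 a b N = mem_sep N M a b N"
      using m1(2) M by (intro mem_sep_cong[OF N ab]) auto
    show "runs (Seq cost_prog (Seq (Block [Sub 26 9 20]) (Cond 26 (Block ?upd) (Block []))))
      m1 (17 * N + 7) (\<lambda>m'. runs (Block ?adv) m' 3 ?Q)"
    proof (rule runs_SeqI[where ?T1.0 = "17 * N" and ?T2.0 = 7], rule runs_mono[OF runs_cost[OF N]])
      fix m2 assume "m2 20 = mem_sep N m1 a b N \<and> (\<forall>x. x < 20 \<or> 27 < x \<longrightarrow> m2 x = m1 x)"
      then have m2: "m2 20 = mem_sep N M a b N" "\<forall>x. x < 20 \<or> 27 < x \<longrightarrow> m2 x = m x"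
        using sep m1(2) by auto
      define m3 where "m3 = fold effect [Sub 26 9 20] m2"
      have m3: "m3 26 = m2 9 - mem_sep N M a b N" "\<forall>x. x \<noteq> 26 \<longrightarrow> m3 x = m2 x"
        using m2 by (simp_all add: m3_def)
      have best2: "best_pair N M W (E \<union> Pair a ` partners N M b) m2"
        by (rule best_pair_cong[OF _ _ _ _ best]) (use m2 in simp_all)
      have best3: "best_pair N M W (E \<union> Pair a ` partners N M b) m3"
        by (rule best_pair_cong[OF _ _ _ _ best2]) (use m3 in simp_all)
      show "runs (Seq (Block [Sub 26 9 20]) (Cond 26 (Block ?upd) (Block []))) m2 7
        (\<lambda>m'. runs (Block ?adv) m' 3 ?Q)"
      proof (rule runs_Block_Seq[where ?T2.0 = 6], simp, fold m3_def, rule runs_CondI[where T' = 4])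
        assume "m3 26 \<noteq> 0"
        then have less: "mem_sep N M a b N < m3 9" using m3 by simp
        show "runs (Block ?upd) m3 4 (\<lambda>m'. runs (Block ?adv) m' 3 ?Q)"
        proof (rule runs_Block, simp, simp, rule adv)
          show "best_pair N M W ?E (fold effect ?upd m3)"
            unfolding E by (rule best_pair_replace[OF best3 less]) (use m3 m2 m in simp_all)
          show "\<forall>x. x \<notin> {9, 11, 12, 13} \<and> (x < 20 \<or> 27 < x) \<longrightarrow> fold effect ?upd m3 x = m x"
            using m3(2) m2(2) by auto
        qed
      next
        assume "m3 26 = 0"
        then have le: "m3 9 \<le> mem_sep N M a b N" using m3 by simp
        show "runs (Block []) m3 4 (\<lambda>m'. runs (Block ?adv) m' 3 ?Q)"
        proof (rule runs_Block, simp, simp, rule adv)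
          show "best_pair N M W ?E (fold effect [] m3)"
            unfolding E using best_pair_keep[OF best3 le] by simp
          show "\<forall>x. x \<notin> {9, 11, 12, 13} \<and> (x < 20 \<or> 27 < x) \<longrightarrow> fold effect [] m3 x = m x"
            using m3(2) m2(2) by auto
        qed
      qed simp_all
    qed (use m m1(2) ab in simp_all)
  qed (use N in simp_all)
qed

text \<open>Together with \<open>cube_ge\<close> it absorbs lower-order terms of running times, with
  the powers of \<open>N\<close> as atoms of linear arithmetic.\<close>

lemma square_ge: "30 \<le> (N::nat) \<Longrightarrow> 30 * N \<le> N * N"
  by (rule mult_le_mono1)

lemma cube_ge: "30 \<le> (N::nat) \<Longrightarrow> 30 * (N * N) \<le> N * N * N"
  unfolding mult.assoc by (rule mult_le_mono1)

lemma runs_partner_loop: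
  assumes N: "30 \<le> N" and m: "m 0 = N" "m 1 = 1" "m 4 = weight_base N" "m 6 = flag_base N"
    "m 15 = row_addr N a" "m 16 = flag_base N + a"
    and a: "1 \<le> a" "a < N" and M: "\<And>x. 27 < x \<Longrightarrow> m x = M x" and best: "best_pair N M W E m"
  shows "runs partner_loop m (19 * (N * N)) (\<lambda>m'. best_pair N M W (E \<union> Pair a ` partners N M a) m' \<and>
    (\<forall>x. x \<notin> {9, 11, 12, 13} \<and> (x < 17 \<or> 27 < x) \<longrightarrow> m' x = m x))" (is "runs _ _ _ ?Q")
proof -
  define I where "I k m' \<longleftrightarrow> (\<exists>b. 1 \<le> b \<and> b + k = a \<and> m' 17 = k \<and> m' 18 = row_addr N b \<and>
    m' 19 = flag_base N + b \<and> best_pair N M W (E \<union> Pair a ` partners N M b) m' \<and>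
    (\<forall>x. x \<notin> {9, 11, 12, 13} \<and> (x < 17 \<or> 27 < x) \<longrightarrow> m' x = m x))" for k m'
  let ?init = "[Sub 17 16 6, Sub 17 17 1, Add 18 0 1, Add 19 6 1]"
  have body: "runs partner_body m' (18 * N) (I k)" if Isuc: "I (Suc k) m'" for k m'
  proof -
    obtain b where b: "1 \<le> b" "b + Suc k = a" and r: "m' 17 = Suc k" "m' 18 = row_addr N b"
      "m' 19 = flag_base N + b" "best_pair N M W (E \<union> Pair a ` partners N M b) m'"
      and fr: "\<forall>x. x \<notin> {9, 11, 12, 13} \<and> (x < 17 \<or> 27 < x) \<longrightarrow> m' x = m x"
      using Isuc unfolding I_def by blast
    show ?thesis
    proof (rule runs_mono[OF runs_partner_body[OF N _ _ _ _ _ r(1-3) a(1) b(1) _ r(4)] order_refl])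
      fix m2
      assume m2: "m2 17 = k \<and> m2 18 = row_addr N (Suc b) \<and> m2 19 = flag_base N + Suc b \<and>
        best_pair N M W (E \<union> Pair a ` partners N M (Suc b)) m2 \<and>
        (\<forall>x. x \<notin> {9, 11, 12, 13} \<and> (x < 17 \<or> 27 < x) \<longrightarrow> m2 x = m' x)"
      show "I k m2" unfolding I_def
        by (rule exI[of _ "Suc b"]) (use m2 b fr in simp)
    qed (use fr m M in simp_all)
  qed
  have "partners N M 1 = {}" by (auto simp: partners_def)
  moreover have "best_pair N M W E (fold effect ?init m)"
    by (rule best_pair_cong[OF _ _ _ _ best]) simp_all
  ultimately have "best_pair N M W (E \<union> Pair a ` partners N M 1) (fold effect ?init m)"
    by simp
  then have "I (a - 1) (fold effect ?init m)" unfolding I_def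
    using m a by (intro exI[of _ 1]) (simp add: row_addr_def)
  then have "runs (While 17 partner_body) (fold effect ?init m) ((a - 1) * (18 * N + 2) + 1) (I 0)"
  proof (rule runs_While[where I = I])
    show "m' 17 = 0 \<longleftrightarrow> k = 0" if "I k m'" for k m' using that unfolding I_def by auto
  qed (rule body)
  then have "runs (While 17 partner_body) (fold effect ?init m) ((a - 1) * (18 * N + 2) + 1) ?Q"
    by (rule runs_mono) (auto simp: I_def)
  moreover have "length ?init + ((a - 1) * (18 * N + 2) + 1) \<le> 19 * (N * N)"
  proof -
    have "(a - 1) * (18 * N + 2) \<le> N * (18 * N + 2)" using a by (intro mult_le_mono1) simp
    moreover have "N * (18 * N + 2) = 18 * (N * N) + 2 * N" by (simp add: algebra_simps)
    moreover have "length ?init = 4" by simp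
    ultimately show ?thesis using square_ge[OF N] N by linarith
  qed
  ultimately show ?thesis unfolding partner_loop_def by (intro runs_Block_Seq) simp_all
qed

text \<open>Register 9 starts at the sentinel. \<open>N + 1\<close> is the address of row 1, so row
  0 is never a candidate.\<close>

definition search_prog :: prog where
  "search_prog = Seq (Block [Add 9 10 1, Sub 14 0 1, Add 15 0 1, Add 16 6 1])
    (While 14 (Seq (Block [Load 25 16])
      (Seq (Cond 25 (Block []) partner_loop) (Block [Add 15 15 0, Add 16 16 1, Sub 14 14 1]))))"

definition alive_pairs :: "nat \<Rightarrow> memory \<Rightarrow> nat \<Rightarrow> (nat \<times> nat) set" where
  "alive_pairs N M n = {(a, b). a \<in> partners N M n \<and> b \<in> partners N M a}"

lemma alive_pairs_Suc:
  "1 \<le> n \<Longrightarrow> alive_pairs N M (Suc n) = (if M (flag_base N + n) = 0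
    then alive_pairs N M n \<union> Pair n ` partners N M n else alive_pairs N M n)"
  by (auto simp: alive_pairs_def partners_Suc)

lemma runs_search:
  assumes N: "30 \<le> N" and M: "M 0 = N" "M 1 = 1" "M 4 = weight_base N" "M 6 = flag_base N" "M 10 = W"
  shows "runs search_prog M (20 * (N * N * N)) (\<lambda>m'. best_pair N M W (alive_pairs N M N) m' \<and>
    (\<forall>x. x < 9 \<or> x = 10 \<or> 27 < x \<longrightarrow> m' x = M x))" (is "runs _ _ _ ?Q")
proof -
  define I where "I k m \<longleftrightarrow> (\<exists>a. 1 \<le> a \<and> a + k = N \<and> m 14 = k \<and> m 15 = row_addr N a \<and>
    m 16 = flag_base N + a \<and> best_pair N M W (alive_pairs N M a) m \<and>
    (\<forall>x. x < 9 \<or> x = 10 \<or> 27 < x \<longrightarrow> m x = M x))" for k m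
  let ?init = "[Add 9 10 1, Sub 14 0 1, Add 15 0 1, Add 16 6 1]"
  let ?adv = "[Add 15 15 0, Add 16 16 1, Sub 14 14 1]"
  let ?body = "Seq (Block [Load 25 16]) (Seq (Cond 25 (Block []) partner_loop) (Block ?adv))"
  have body: "runs ?body m (19 * (N * N) + 6) (I k)" if Isuc: "I (Suc k) m" for k m
  proof -
    obtain a where a: "1 \<le> a" "a + Suc k = N" and r: "m 14 = Suc k" "m 15 = row_addr N a"
      "m 16 = flag_base N + a" and best: "best_pair N M W (alive_pairs N M a) m"
      and fr: "\<forall>x. x < 9 \<or> x = 10 \<or> 27 < x \<longrightarrow> m x = M x"
      using Isuc unfolding I_def by blast
    have adv: "runs (Block ?adv) m2 3 (I k)"
      if m2: "\<forall>x. x \<notin> {9, 11, 12, 13} \<and> (x < 17 \<or> 27 < x) \<longrightarrow> m2 x = m x"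
        "best_pair N M W (alive_pairs N M (Suc a)) m2" for m2
    proof (rule runs_Block)
      have "best_pair N M W (alive_pairs N M (Suc a)) (fold effect ?adv m2)"
        by (rule best_pair_cong[OF _ _ _ _ m2(2)]) simp_all
      moreover have "m2 0 = N" "m2 (Suc 0) = 1" "m2 14 = Suc k" "m2 15 = row_addr N a"
        "m2 16 = flag_base N + a" "\<forall>x. x < 9 \<or> x = 10 \<or> 27 < x \<longrightarrow> m2 x = M x"
        using m2(1) r fr M by auto
      ultimately show "I k (fold effect ?adv m2)" unfolding I_def using a
        by (intro exI[of _ "Suc a"]) (auto simp: row_addr_def)
    qed simp_all
    define m1 where "m1 = fold effect [Load 25 16] m"
    have "m (flag_base N + a) = M (flag_base N + a)" using N fr by (simp add: flag_base_def)
    then have m1: "m1 25 = M (flag_base N + a)" "\<forall>x. x \<noteq> 25 \<longrightarrow> m1 x = m x"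
      using r by (simp_all add: m1_def)
    have best1: "best_pair N M W (alive_pairs N M a) m1"
      by (rule best_pair_cong[OF _ _ _ _ best]) (use m1 in simp_all)
    show ?thesis
    proof (rule runs_Block_Seq[where ?T2.0 = "19 * (N * N) + 5"], simp, fold m1_def,
        rule runs_SeqI[where ?T1.0 = "19 * (N * N) + 2" and ?T2.0 = 3], rule runs_CondI[where T' = "19 * (N * N)"])
      assume "m1 25 \<noteq> 0"
      then have "alive_pairs N M (Suc a) = alive_pairs N M a" using a m1 by (simp add: alive_pairs_Suc)
      then show "runs (Block []) m1 (19 * (N * N)) (\<lambda>m'. runs (Block ?adv) m' 3 (I k))"
        using best1 m1(2) by (intro runs_Block adv) auto
    next
      assume "m1 25 = 0"
      then have E: "alive_pairs N M (Suc a) = alive_pairs N M a \<union> Pair a ` partners N M a"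
        using a m1 by (simp add: alive_pairs_Suc)
      have aN: "a < N" using a by simp
      show "runs partner_loop m1 (19 * (N * N)) (\<lambda>m'. runs (Block ?adv) m' 3 (I k))"
      proof (rule runs_mono[OF runs_partner_loop[OF N _ _ _ _ _ _ a(1) aN _ best1] order_refl])
        fix m2
        assume "best_pair N M W (alive_pairs N M a \<union> Pair a ` partners N M a) m2 \<and>
          (\<forall>x. x \<notin> {9, 11, 12, 13} \<and> (x < 17 \<or> 27 < x) \<longrightarrow> m2 x = m1 x)"
        then show "runs (Block ?adv) m2 3 (I k)" using m1(2) unfolding E[symmetric] by (intro adv) auto
      qed (use m1 r fr M in simp_all)
    qed simp_all
  qed
  have "alive_pairs N M 1 = {}" by (auto simp: partners_def alive_pairs_def)
  then have "I (N - 1) (fold effect ?init M)" unfolding I_def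
    using M N by (intro exI[of _ 1]) (auto simp: row_addr_def best_pair_def)
  then have "runs (While 14 ?body) (fold effect ?init M) ((N - 1) * (19 * (N * N) + 6 + 2) + 1) (I 0)"
  proof (rule runs_While[where I = I])
    show "m' 14 = 0 \<longleftrightarrow> k = 0" if "I k m'" for k m' using that unfolding I_def by auto
  qed (rule body)
  then have "runs (While 14 ?body) (fold effect ?init M) ((N - 1) * (19 * (N * N) + 6 + 2) + 1) ?Q"
    by (rule runs_mono) (auto simp: I_def)
  moreover have "length ?init + ((N - 1) * (19 * (N * N) + 6 + 2) + 1) \<le> 20 * (N * N * N)"
  proof -
    have "(N - 1) * (19 * (N * N) + 6 + 2) \<le> N * (19 * (N * N) + 6 + 2)" by (intro mult_le_mono1) simp
    moreover have "N * (19 * (N * N) + 6 + 2) = 19 * (N * N * N) + 8 * N" by (simp add: algebra_simps)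
    moreover have "length ?init = 4" by simp
    ultimately show ?thesis using square_ge[OF N] cube_ge[OF N] N by linarith
  qed
  ultimately show ?thesis unfolding search_prog_def by (intro runs_Block_Seq) simp_all
qed

text \<open>Register 13 addresses the flag of the row to discard. The total weight in register 10
  grows by the cost of the chosen pair, still held in register 9.\<close>

definition iteration_prog :: prog where
  "iteration_prog = Seq search_prog (Seq update_prog (Block [Store 13 1, Add 10 10 9, Sub 8 8 1]))"

lemma runs_iteration:
  assumes N: "30 \<le> N" and M: "M 0 = N" "M 1 = 1" "M 4 = weight_base N" "M 6 = flag_base N" "M 10 = W"
    and ne: "alive_pairs N M N \<noteq> {}" and W: "\<And>a b. (a, b) \<in> alive_pairs N M N \<Longrightarrow> mem_sep N M a b N \<le> W"
  shows "runs iteration_prog M (21 * (N * N * N)) (\<lambda>m. \<exists>a b. (a, b) \<in> alive_pairs N M N \<and>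
    (\<forall>a' b'. (a', b') \<in> alive_pairs N M N \<longrightarrow> mem_sep N M a b N \<le> mem_sep N M a' b' N) \<and>
    m 0 = N \<and> m 1 = 1 \<and> m 4 = weight_base N \<and> m 6 = flag_base N \<and> m 8 = M 8 - 1 \<and>
    m 10 = W + mem_sep N M a b N \<and>
    (\<forall>j<N. m (weight_base N + j) = (if M (row_addr N a + j) = M (row_addr N b + j)
        then M (weight_base N + j) else Suc (2 * M (weight_base N + j)))) \<and>
    (\<forall>x. 27 < x \<and> (x < weight_base N \<or> flag_base N \<le> x) \<longrightarrow>
       m x = (if x = flag_base N + a then 1 else M x)))" (is "runs _ _ _ ?Q")
  unfolding iteration_prog_def
proof (rule runs_SeqI[where ?T2.0 = "18 * N + 3"], rule runs_mono[OF runs_search[OF N M] order_refl])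
  fix m assume "best_pair N M W (alive_pairs N M N) m \<and> (\<forall>x. x < 9 \<or> x = 10 \<or> 27 < x \<longrightarrow> m x = M x)"
  then have best: "best_pair N M W (alive_pairs N M N) m" and fr: "\<forall>x. x < 9 \<or> x = 10 \<or> 27 < x \<longrightarrow> m x = M x"
    by auto
  \<comment> \<open>Some pair exists and costs at most \<open>W\<close>, so the sentinel has been
    replaced.\<close>
  have "m 9 \<noteq> Suc W"
  proof
    assume "m 9 = Suc W"
    obtain a b where ab: "(a, b) \<in> alive_pairs N M N" using ne by auto
    then have "m 9 \<le> mem_sep N M a b N" using best by (simp add: best_pair_def)
    then show False using W[OF ab] \<open>m 9 = Suc W\<close> by simp
  qed
  then obtain a b where ab: "(a, b) \<in> alive_pairs N M N" and r: "m 9 = mem_sep N M a b N"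
    "m 11 = row_addr N a" "m 12 = row_addr N b" "m 13 = flag_base N + a"
    using best by (auto simp: best_pair_def)
  have min: "\<forall>a' b'. (a', b') \<in> alive_pairs N M N \<longrightarrow> mem_sep N M a b N \<le> mem_sep N M a' b' N"
    using best r(1) by (simp add: best_pair_def)
  have ab': "1 \<le> a" "a < N" "1 \<le> b" "b < N" using ab by (auto simp: alive_pairs_def partners_def)
  have base: "27 < row_addr N a" "27 < row_addr N b" "27 < weight_base N" "flag_base N = weight_base N + N"
    using row_addr_bounds(1)[OF ab'(1), of N] row_addr_bounds(1)[OF ab'(3), of N] N mult_le_mono[OF N N]
    by (auto simp: weight_base_def flag_base_def)
  show "runs (Seq update_prog (Block [Store 13 1, Add 10 10 9, Sub 8 8 1])) m (18 * N + 3) ?Q"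
  proof (rule runs_SeqI[where ?T1.0 = "18 * N" and ?T2.0 = 3],
      rule runs_mono[OF runs_update[OF N _ _ _ r(2,3) ab'] order_refl])
    fix m2 assume m2: "(\<forall>j<N. m2 (weight_base N + j) = (if m (row_addr N a + j) = m (row_addr N b + j)
        then m (weight_base N + j) else Suc (2 * m (weight_base N + j)))) \<and>
      (\<forall>x. (x < 20 \<or> 27 < x) \<and> (x < weight_base N \<or> weight_base N + N \<le> x) \<longrightarrow> m2 x = m x)"
    have regs: "m2 0 = N" "m2 (Suc 0) = 1" "m2 4 = weight_base N" "m2 6 = flag_base N" "m2 8 = M 8"
      "m2 10 = W" "m2 9 = mem_sep N M a b N" "m2 13 = weight_base N + N + a"
      using m2 fr M r base by auto
    have upd: "m2 (weight_base N + j) = (if M (row_addr N a + j) = M (row_addr N b + j)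
        then M (weight_base N + j) else Suc (2 * M (weight_base N + j)))" if "j < N" for j
      using m2 that fr base by simp
    have rest: "m2 x = M x" if "27 < x" "x < weight_base N \<or> weight_base N + N \<le> x" for x
      using m2 fr that by simp
    show "runs (Block [Store 13 1, Add 10 10 9, Sub 8 8 1]) m2 3 ?Q"
    proof (rule runs_Block, simp, simp, rule exI[of _ a], rule exI[of _ b], intro conjI)
      let ?m3 = "fold effect [Store 13 1, Add 10 10 9, Sub 8 8 1] m2"
      show "\<forall>j<N. ?m3 (weight_base N + j) = (if M (row_addr N a + j) = M (row_addr N b + j)
        then M (weight_base N + j) else Suc (2 * M (weight_base N + j)))"
        using upd regs base by simp
      show "\<forall>x. 27 < x \<and> (x < weight_base N \<or> flag_base N \<le> x) \<longrightarrow>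
       ?m3 x = (if x = flag_base N + a then 1 else M x)"
        using rest regs base by simp
    qed (use ab min regs base in simp_all)
  qed (use fr M in simp_all)
next
  show "20 * (N * N * N) + (18 * N + 3) \<le> 21 * (N * N * N)"
    using square_ge[OF N] cube_ge[OF N] N by linarith
qed

section \<open>The machine follows the greedy merging\<close>

text \<open>Row 0 is left out because the scratch registers overwrite part of it.\<close>

definition represents :: "real mat \<Rightarrow> nat \<Rightarrow> nat set \<Rightarrow> (nat \<Rightarrow> nat) \<Rightarrow> memory \<Rightarrow> bool" where
  "represents S N A v m \<longleftrightarrow>
    (\<forall>i j. 1 \<le> i \<and> i < N \<and> j < N \<longrightarrow> m (row_addr N i + j) = (if S $$ (i, j) = 1 then 1 else 0)) \<and>
    (\<forall>j<N. m (weight_base N + j) = v j) \<and>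
    (\<forall>i. 1 \<le> i \<and> i < N \<longrightarrow> (m (flag_base N + i) = 0 \<longleftrightarrow> i \<in> A))"

lemma represents_row_eq:
  assumes S: "S \<in> sign_matrices N N" and m: "represents S N A v m"
    and ab: "1 \<le> a" "a < N" "1 \<le> b" "b < N" "j < N"
  shows "m (row_addr N a + j) = m (row_addr N b + j) \<longleftrightarrow> S $$ (a, j) = S $$ (b, j)"
  using m ab sign_matricesD(2)[OF S ab(2,5)] sign_matricesD(2)[OF S ab(4,5)]
  by (auto simp: represents_def)

lemma represents_mem_sep:
  assumes S: "S \<in> sign_matrices N N" and m: "represents S N A v m"
    and ab: "1 \<le> a" "a < N" "1 \<le> b" "b < N"
  shows "mem_sep N m a b N = sep_weight S N v a b"
  unfolding mem_sep_def sep_weight_def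
proof (rule sum.cong)
  fix j assume "j \<in> {..<N}"
  then have "m (weight_base N + j) = v j" "j < N" using m by (auto simp: represents_def)
  then show "(if m (row_addr N a + j) = m (row_addr N b + j) then 0 else Suc (m (weight_base N + j)))
      = (if S $$ (a, j) = S $$ (b, j) then 0 else Suc (v j))"
    using represents_row_eq[OF S m ab] by simp
qed simp

lemma represents_alive_pairs:
  assumes "represents S N A v m" "A \<subseteq> {1..<N}"
  shows "(a, b) \<in> alive_pairs N m N \<longleftrightarrow> a \<in> A \<and> b \<in> A \<and> b < a"
proof -
  have "i \<in> partners N m n \<longleftrightarrow> i \<in> A \<and> i < n" if "n \<le> N" for i n
    using assms that by (auto simp: represents_def partners_def)
  then show ?thesis unfolding alive_pairs_def using assms(2) by fastforce
qed

lemma sep_weight_commute: "sep_weight S n v a b = sep_weight S n v b a"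
  unfolding sep_weight_def by (intro sum.cong) auto

lemma sep_weight_le: "sep_weight S n v a b \<le> (\<Sum>j<n. Suc (v j))"
  unfolding sep_weight_def by (intro sum_mono) auto

text \<open>\<open>k\<close> counts the remaining rounds: with \<open>k + 1\<close> rows present,
  one survives at \<open>k = 0\<close>.\<close>

definition loop_state :: "real mat \<Rightarrow> nat \<Rightarrow> nat \<Rightarrow> memory \<Rightarrow> bool" where
  "loop_state S N k m \<longleftrightarrow> (\<exists>A v. greedy_inv S N A v \<and> card A = Suc k \<and> represents S N A v m \<and>
    m 0 = N \<and> m 1 = 1 \<and> m 4 = weight_base N \<and> m 6 = flag_base N \<and> m 8 = k \<and>
    m 10 = (\<Sum>j<N. Suc (v j)))"

lemma runs_iteration_loop_state:
  assumes S: "S \<in> sign_matrices N N" and N: "30 \<le> N" and m: "loop_state S N (Suc k) m"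
  shows "runs iteration_prog m (21 * (N * N * N)) (loop_state S N k)"
proof -
  obtain A v where inv: "greedy_inv S N A v" "card A = Suc (Suc k)" and rep: "represents S N A v m"
    and r: "m 0 = N" "m 1 = 1" "m 4 = weight_base N" "m 6 = flag_base N" "m 8 = Suc k"
      "m 10 = (\<Sum>j<N. Suc (v j))"
    using m unfolding loop_state_def by blast
  have A: "A \<subseteq> {1..<N}" using inv by (simp add: greedy_inv_def)
  have rng: "1 \<le> a" "a < N" if "a \<in> A" for a using that A by auto
  note pairs = represents_alive_pairs[OF rep A]
  have sep: "mem_sep N m a b N = sep_weight S N v a b" if "a \<in> A" "b \<in> A" for a b
    using represents_mem_sep[OF S rep] rng that by blast
  have "finite A" using A finite_subset by blast
  then have "\<not> (\<forall>a\<in>A. \<forall>b\<in>A. a = b)" using card_le_Suc0_iff_eq[of A] inv(2) by simp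
  then obtain a b where "a \<in> A" "b \<in> A" "a \<noteq> b" by blast
  then have "(a, b) \<in> alive_pairs N m N \<or> (b, a) \<in> alive_pairs N m N" by (auto simp: pairs)
  then have ne: "alive_pairs N m N \<noteq> {}" by blast
  have le: "mem_sep N m a b N \<le> (\<Sum>j<N. Suc (v j))" if "(a, b) \<in> alive_pairs N m N" for a b
    using that sep sep_weight_le by (simp add: pairs)
  show ?thesis
  proof (rule runs_mono[OF runs_iteration[OF N r(1-4) r(6) ne le] order_refl])
    fix m'
    assume "\<exists>a b. (a, b) \<in> alive_pairs N m N \<and>
      (\<forall>a' b'. (a', b') \<in> alive_pairs N m N \<longrightarrow> mem_sep N m a b N \<le> mem_sep N m a' b' N) \<and>
      m' 0 = N \<and> m' 1 = 1 \<and> m' 4 = weight_base N \<and> m' 6 = flag_base N \<and> m' 8 = m 8 - 1 \<and>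
      m' 10 = (\<Sum>j<N. Suc (v j)) + mem_sep N m a b N \<and>
      (\<forall>j<N. m' (weight_base N + j) = (if m (row_addr N a + j) = m (row_addr N b + j)
          then m (weight_base N + j) else Suc (2 * m (weight_base N + j)))) \<and>
      (\<forall>x. 27 < x \<and> (x < weight_base N \<or> flag_base N \<le> x) \<longrightarrow>
         m' x = (if x = flag_base N + a then 1 else m x))"
    then obtain a b where ab0: "(a, b) \<in> alive_pairs N m N"
      and min0: "\<forall>a' b'. (a', b') \<in> alive_pairs N m N \<longrightarrow> mem_sep N m a b N \<le> mem_sep N m a' b' N"
      and r': "m' 0 = N" "m' 1 = 1" "m' 4 = weight_base N" "m' 6 = flag_base N" "m' 8 = m 8 - 1"
        "m' 10 = (\<Sum>j<N. Suc (v j)) + mem_sep N m a b N"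
      and w': "\<forall>j<N. m' (weight_base N + j) = (if m (row_addr N a + j) = m (row_addr N b + j)
          then m (weight_base N + j) else Suc (2 * m (weight_base N + j)))"
      and fr: "\<forall>x. 27 < x \<and> (x < weight_base N \<or> flag_base N \<le> x) \<longrightarrow>
         m' x = (if x = flag_base N + a then 1 else m x)"
      by blast
    have ab: "a \<in> A" "b \<in> A" "a \<noteq> b" using ab0 by (auto simp: pairs)
    \<comment> \<open>The search covers pairs with \<open>b < a\<close>; symmetry of
      \<open>sep_weight\<close> extends minimality to all pairs.\<close>
    have min: "sep_weight S N v a b \<le> sep_weight S N v a' b'" if "a' \<in> A" "b' \<in> A" "a' \<noteq> b'" for a' b'
    proof (cases "b' < a'")
      case True
      then have "(a', b') \<in> alive_pairs N m N" using that by (simp add: pairs)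
      then have "mem_sep N m a b N \<le> mem_sep N m a' b' N" using min0 by blast
      then show ?thesis by (simp add: sep that ab)
    next
      case False
      then have "(b', a') \<in> alive_pairs N m N" using that by (simp add: pairs)
      then have "mem_sep N m a b N \<le> mem_sep N m b' a' N" using min0 by blast
      then show ?thesis by (simp add: sep that ab sep_weight_commute[of S N v a'])
    qed
    have base: "27 < weight_base N" "flag_base N = weight_base N + N"
      using mult_le_mono[OF N N] by (auto simp: weight_base_def flag_base_def)
    have "represents S N (A - {a}) (double_weights S a b v) m'"
      unfolding represents_def
    proof (intro conjI allI impI)
      fix i j assume ij: "1 \<le> i \<and> i < N \<and> j < N"
      then have lt: "row_addr N i + j < weight_base N" "27 < row_addr N i + j"
        using row_addr_bounds(2)[of i N j] row_addr_bounds(1)[of i N] N by auto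
      then have "m' (row_addr N i + j) = m (row_addr N i + j)" using fr base by simp
      then show "m' (row_addr N i + j) = (if S $$ (i, j) = 1 then 1 else 0)"
        using rep ij by (simp add: represents_def)
    next
      fix j assume j: "j < N"
      have "m (weight_base N + j) = v j" using rep j by (simp add: represents_def)
      then show "m' (weight_base N + j) = double_weights S a b v j"
        using w' j represents_row_eq[OF S rep rng(1,2)[OF ab(1)] rng(1,2)[OF ab(2)] j]
        by (simp add: double_weights_def)
    next
      fix i assume i: "1 \<le> i \<and> i < N"
      have "m' (flag_base N + i) = (if i = a then 1 else m (flag_base N + i))"
        using fr base by simp
      then show "m' (flag_base N + i) = 0 \<longleftrightarrow> i \<in> A - {a}"
        using rep i by (simp add: represents_def)
    qed
    moreover have "greedy_inv S N (A - {a}) (double_weights S a b v)"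
      by (rule greedy_inv_step[OF S inv(1) ab min])
    moreover have "card (A - {a}) = Suc k" using inv(2) ab(1) by simp
    moreover have "m' 10 = (\<Sum>j<N. Suc (double_weights S a b v j))"
      unfolding sum_double_weights r'(6) using sep[OF ab(1,2)] by simp
    moreover have "m' 8 = k" using r'(5) r(5) by simp
    ultimately show "loop_state S N k m'" unfolding loop_state_def using r'(1-4) by blast
  qed
qed

text \<open>This bounds the running time of \<open>log_prog\<close> whatever the sign rank: by the
  cap 1 in \<open>close_frac\<close> a round at most doubles the total weight.\<close>

lemma greedy_inv_log_weight:
  assumes inv: "greedy_inv S n A v" and A: "card A = 1"
    and l: "l = 0 \<or> 2 ^ (l - 1) < (\<Sum>j<n. Suc (v j))"
  shows "l \<le> 2 * n"
proof (cases "l = 0")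
  case False
  define d where "d = sign_rank S"
  have "real (\<Sum>j<n. Suc (v j)) \<le> real n * (\<Prod>m\<in>{1<..<n}. 1 + close_frac d m)"
    using inv A by (simp add: greedy_inv_def d_def)
  also have "\<dots> \<le> real n * (\<Prod>m\<in>{1<..<n}. 2)"
    by (intro mult_left_mono prod_mono) (auto simp: close_frac_def)
  also have "\<dots> \<le> 2 ^ n * 2 ^ n"
    by (intro mult_mono) (auto intro: less_imp_le power_increasing)
  finally have "real (\<Sum>j<n. Suc (v j)) \<le> 2 ^ (2 * n)" by (simp add: mult_2 power_add)
  moreover have "real (2 ^ (l - 1)) < real (\<Sum>j<n. Suc (v j))"
    using l False by (simp only: of_nat_less_iff) simp
  ultimately have "real (2 ^ (l - 1)) < 2 ^ (2 * n)" by linarith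
  then have "l - 1 < 2 * n" by simp
  then show ?thesis by simp
qed simp

section \<open>Logarithm, initialisation and small orders\<close>

text \<open>Register 2 runs through the powers \<open>2 ^ i\<close> until the truncated difference
  \<open>W - 2 ^ i\<close> vanishes, while register 0 counts \<open>2 * i + 2\<close>, the bound of
  \<open>merge_tree_final\<close>.\<close>

definition log_prog :: prog where
  "log_prog = Seq (Block [Const 0 2, Const 2 1, Sub 3 10 2])
    (While 3 (Block [Add 2 2 2, Add 0 0 1, Add 0 0 1, Sub 3 10 2]))"

lemma runs_log:
  assumes m: "m 1 = 1" "m 10 = W" and L: "W \<le> 2 ^ L" "\<And>i. i < L \<Longrightarrow> 2 ^ i < W"
  shows "runs log_prog m (6 * L + 4) (\<lambda>m'. m' 0 = 2 * L + 2)"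
proof -
  define I where "I k m' \<longleftrightarrow> (\<exists>i. i + k = L \<and> m' 2 = 2 ^ i \<and> m' 0 = 2 * i + 2 \<and>
    m' 3 = W - 2 ^ i \<and> m' 1 = 1 \<and> m' 10 = W)" for k and m' :: memory
  let ?init = "[Const 0 2, Const 2 1, Sub 3 10 2]"
  let ?body = "[Add 2 2 2, Add 0 0 1, Add 0 0 1, Sub 3 10 2]"
  have "runs (While 3 (Block ?body)) (fold effect ?init m) (L * (4 + 2) + 1) (I 0)"
  proof (rule runs_While[where I = I])
    show "I L (fold effect ?init m)" unfolding I_def by (rule exI[of _ 0]) (use m in simp)
    show "m' 3 = 0 \<longleftrightarrow> k = 0" if "I k m'" for k m'
    proof -
      obtain i where i: "i + k = L" "m' 3 = W - 2 ^ i" using \<open>I k m'\<close> unfolding I_def by blast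
      show ?thesis using L(1) L(2)[of i] i by (cases "k = 0") auto
    qed
    show "runs (Block ?body) m' 4 (I k)" if "I (Suc k) m'" for k m'
    proof (rule runs_Block)
      obtain i where i: "i + Suc k = L" "m' 2 = 2 ^ i" "m' 0 = 2 * i + 2" "m' (Suc 0) = 1" "m' 10 = W"
        using \<open>I (Suc k) m'\<close> unfolding I_def by auto
      show "I k (fold effect ?body m')" unfolding I_def
        by (rule exI[of _ "Suc i"]) (use i in simp)
    qed simp_all
  qed
  then have "runs (While 3 (Block ?body)) (fold effect ?init m) (L * (4 + 2) + 1) (\<lambda>m'. m' 0 = 2 * L + 2)"
    by (rule runs_mono) (auto simp: I_def)
  then show ?thesis unfolding log_prog_def by (rule runs_Block_Seq[rotated]) (simp_all add: mult.commute)
qed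

text \<open>The machine cannot multiply, so \<open>N * N\<close> is computed by \<open>N\<close>
  additions. Merging \<open>N - 1\<close> rows takes \<open>N - 2\<close> rounds, and the initial
  total weight is \<open>N\<close>.\<close>

definition greedy_prog :: prog where
  "greedy_prog = Seq (Block [Const 4 0, Move 5 0])
    (Seq (While 5 (Block [Add 4 4 0, Sub 5 5 1]))
    (Seq (Block [Add 4 4 1, Add 6 4 0, Move 10 0, Sub 8 0 1, Sub 8 8 1])
    (Seq (While 8 iteration_prog) log_prog)))"

text \<open>A constant output handles all orders below 30, among them those in which the scratch
  registers reach beyond row 0.\<close>

definition approx_prog :: prog where
  "approx_prog = Seq (Block [Const 1 1, Const 2 30, Sub 3 2 0])
    (Cond 3 (Block [Const 0 30]) greedy_prog)"

definition good_approx :: "real mat \<Rightarrow> nat \<Rightarrow> nat \<Rightarrow> bool" where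
  "good_approx S N s \<longleftrightarrow> sign_rank S \<le> s \<and>
     real s \<le> 124 * (real N / ln (real N)) * real (sign_rank S)"

lemma runs_greedy_loop:
  assumes S: "S \<in> sign_matrices N N" and N: "30 \<le> N" and m: "loop_state S N (N - 2) m"
  shows "runs (Seq (While 8 iteration_prog) log_prog) m (22 * (N * N * N * N)) (\<lambda>m'. good_approx S N (m' 0))"
proof (rule runs_SeqI[where ?T1.0 = "(N - 2) * (21 * (N * N * N) + 2) + 1" and ?T2.0 = "12 * N + 4"])
  have "runs (While 8 iteration_prog) m ((N - 2) * (21 * (N * N * N) + 2) + 1) (loop_state S N 0)"
  proof (rule runs_While[where I = "loop_state S N"])
    show "m' 8 = 0 \<longleftrightarrow> k = 0" if "loop_state S N k m'" for k m'
      using that unfolding loop_state_def by auto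
  qed (use m runs_iteration_loop_state[OF S N] in auto)
  then show "runs (While 8 iteration_prog) m ((N - 2) * (21 * (N * N * N) + 2) + 1)
    (\<lambda>m'. runs log_prog m' (12 * N + 4) (\<lambda>m'. good_approx S N (m' 0)))"
  proof (rule runs_mono[OF _ order_refl])
    fix m' assume "loop_state S N 0 m'"
    then obtain A v where inv: "greedy_inv S N A v" "card A = 1" and r: "m' 1 = 1" "m' 10 = (\<Sum>j<N. Suc (v j))"
      unfolding loop_state_def by auto
    define W where "W = (\<Sum>j<N. Suc (v j))"
    \<comment> \<open>The least such exponent is where the loop of \<open>log_prog\<close>
      stops.\<close>
    define L where "L = (LEAST l. W \<le> 2 ^ l)"
    have "W \<le> 2 ^ W" by (simp add: less_imp_le)
    then have L1: "W \<le> 2 ^ L" unfolding L_def by (rule LeastI)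
    have L2: "2 ^ i < W" if "i < L" for i
      using not_less_Least[of i "\<lambda>l. W \<le> 2 ^ l"] that by (simp add: L_def)
    have L3: "L = 0 \<or> 2 ^ (L - 1) < W" using L2[of "L - 1"] by (cases "L = 0") simp_all
    have "good_approx S N (2 * L + 2)"
      using greedy_inv_final[OF S _ inv L1[unfolded W_def] L3[unfolded W_def]] N
      by (simp add: good_approx_def)
    moreover have "L \<le> 2 * N" by (rule greedy_inv_log_weight[OF inv L3[unfolded W_def]])
    moreover have "runs log_prog m' (6 * L + 4) (\<lambda>m'. m' 0 = 2 * L + 2)"
      by (rule runs_log[where W = W]) (use r W_def L1 L2 in simp_all)
    ultimately show "runs log_prog m' (12 * N + 4) (\<lambda>m'. good_approx S N (m' 0))"
      by (elim runs_mono) simp_all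
  qed
  have "(N - 2) * (21 * (N * N * N) + 2) \<le> N * (21 * (N * N * N) + 2)" by (intro mult_le_mono1) simp
  moreover have "N * (21 * (N * N * N) + 2) = 21 * (N * N * N * N) + 2 * N" by (simp add: algebra_simps)
  moreover have "30 * (N * N * N) \<le> N * N * N * N"
    using mult_le_mono1[OF N, of "N * N * N"] by (simp add: mult.assoc)
  ultimately show "(N - 2) * (21 * (N * N * N) + 2) + 1 + (12 * N + 4) \<le> 22 * (N * N * N * N)"
    using square_ge[OF N] cube_ge[OF N] N by linarith
qed

lemma length_concat_map_upt:
  assumes "\<And>i. i < n \<Longrightarrow> length (g i) = k"
  shows "length (concat (map g [0..<n])) = n * k"
  using assms by (induction n) auto

lemma nth_concat_map_upt:
  assumes "\<And>i. i < n \<Longrightarrow> length (g i) = k" "i < n" "j < k"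
  shows "concat (map g [0..<n]) ! (i * k + j) = g i ! j"
  using assms
proof (induction n)
  case (Suc n)
  have len: "length (concat (map g [0..<n])) = n * k"
    by (rule length_concat_map_upt) (use Suc.prems in simp)
  show ?case
  proof (cases "i = n")
    case True
    then show ?thesis by (simp add: nth_append len)
  next
    case False
    then have i: "i < n" using Suc.prems by simp
    have "Suc i * k \<le> n * k" using i by (intro mult_le_mono1) simp
    then have "i * k + j < n * k" using Suc.prems by simp
    then show ?thesis using Suc.IH i Suc.prems by (simp add: nth_append len)
  qed
qed simp

definition input_memory :: "real mat \<Rightarrow> memory" where
  "input_memory S = snd (init_config (encode_sign_matrix S))"

lemma length_encode:
  "S \<in> carrier_mat N N \<Longrightarrow> length (encode_sign_matrix S) = Suc (N * N)"
  using length_concat_map_upt[of N "\<lambda>i. map (\<lambda>j. if S $$ (i, j) = 1 then 1 else (0::nat)) [0..<N]" N]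
  by (simp add: encode_sign_matrix_def)

lemma input_memory:
  assumes S: "S \<in> carrier_mat N N"
  shows "input_memory S 0 = N"
    and "i < N \<Longrightarrow> j < N \<Longrightarrow> input_memory S (row_addr N i + j) = (if S $$ (i, j) = 1 then 1 else 0)"
    and "N * N < x \<Longrightarrow> input_memory S x = 0"
proof -
  note len = length_encode[OF S]
  show "input_memory S 0 = N"
    using S by (simp add: input_memory_def init_config_def encode_sign_matrix_def)
  show "input_memory S x = 0" if "N * N < x"
    using that by (simp add: input_memory_def init_config_def len)
  assume ij: "i < N" "j < N"
  have "Suc i * N \<le> N * N" using ij by (intro mult_le_mono1) simp
  then have "row_addr N i + j < length (encode_sign_matrix S)"
    using ij unfolding len by (simp add: row_addr_def)
  then have "input_memory S (row_addr N i + j) = encode_sign_matrix S ! Suc (i * N + j)"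
    by (simp add: input_memory_def init_config_def row_addr_def)
  also have "\<dots> = (if S $$ (i, j) = 1 then 1 else 0)"
    using S ij nth_concat_map_upt[of N "\<lambda>i. map (\<lambda>j. if S $$ (i, j) = 1 then 1 else (0::nat)) [0..<N]" N i j]
    by (simp add: encode_sign_matrix_def)
  finally show "input_memory S (row_addr N i + j) = (if S $$ (i, j) = 1 then 1 else 0)" .
qed

lemma runs_greedy_prog:
  assumes S: "S \<in> sign_matrices N N" and N: "30 \<le> N" and m: "m 0 = N" "m 1 = 1"
    and input: "\<And>x. 27 < x \<Longrightarrow> m x = input_memory S x"
  shows "runs greedy_prog m (23 * (N * N * N * N)) (\<lambda>m'. good_approx S N (m' 0))"
proof -
  note carr = sign_matricesD(1)[OF S]
  define I where "I k m' \<longleftrightarrow> (\<exists>n. n + k = N \<and> m' 4 = n * N \<and> m' 5 = k \<and>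
    (\<forall>x. x \<noteq> 4 \<and> x \<noteq> 5 \<longrightarrow> m' x = m x))" for k m'
  let ?init = "[Add 4 4 1, Add 6 4 0, Move 10 0, Sub 8 0 1, Sub 8 8 1]"
  let ?sq = "[Add 4 4 0, Sub 5 5 1]"
  have sq: "runs (While 5 (Block ?sq)) (fold effect [Const 4 0, Move 5 0] m) (N * (2 + 2) + 1) (I 0)"
  proof (rule runs_While[where I = I])
    show "I N (fold effect [Const 4 0, Move 5 0] m)" unfolding I_def
      by (rule exI[of _ 0]) (use m in simp)
    show "m' 5 = 0 \<longleftrightarrow> k = 0" if "I k m'" for k m' using that unfolding I_def by auto
    show "runs (Block ?sq) m' 2 (I k)" if "I (Suc k) m'" for k m'
    proof (rule runs_Block)
      obtain n where n: "n + Suc k = N" "m' 4 = n * N" "m' 5 = Suc k"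
        and fr: "\<forall>x. x \<noteq> 4 \<and> x \<noteq> 5 \<longrightarrow> m' x = m x"
        using \<open>I (Suc k) m'\<close> unfolding I_def by blast
      have "m' 0 = N" "m' (Suc 0) = 1" using fr m by auto
      then show "I k (fold effect ?sq m')" unfolding I_def using n fr
        by (intro exI[of _ "Suc n"]) simp
    qed simp_all
  qed
  have main: "runs (Seq (Block ?init) (Seq (While 8 iteration_prog) log_prog)) m2
      (22 * (N * N * N * N) + 5) (\<lambda>m'. good_approx S N (m' 0))" if "I 0 m2" for m2
  proof (rule runs_Block_Seq)
    have m2: "m2 4 = N * N" "m2 0 = N" "m2 (Suc 0) = 1" "\<And>x. 27 < x \<Longrightarrow> m2 x = input_memory S x"
      using that m input unfolding I_def by auto
    define m3 where "m3 = fold effect ?init m2"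
    have base: "27 < weight_base N" "27 < flag_base N"
      using mult_le_mono[OF N N] by (auto simp: weight_base_def flag_base_def)
    have hi: "m3 x = input_memory S x" if "27 < x" for x using m2(4) that by (simp add: m3_def)
    have "represents S N {1..<N} (\<lambda>_. 0) m3"
      unfolding represents_def
    proof (intro conjI allI impI)
      fix i j assume ij: "1 \<le> i \<and> i < N \<and> j < N"
      then have "27 < row_addr N i + j" using row_addr_bounds(1)[of i N] N by auto
      from hi[OF this] show "m3 (row_addr N i + j) = (if S $$ (i, j) = 1 then 1 else 0)"
        using input_memory(2)[OF carr] ij by simp
    next
      fix j
      have "m3 (weight_base N + j) = input_memory S (weight_base N + j)" using base by (intro hi) simp
      then show "m3 (weight_base N + j) = 0"
        using input_memory(3)[OF carr] by (simp add: weight_base_def)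
    next
      fix i assume i: "1 \<le> i \<and> i < N"
      have "m3 (flag_base N + i) = input_memory S (flag_base N + i)" using base by (intro hi) simp
      then show "m3 (flag_base N + i) = 0 \<longleftrightarrow> i \<in> {1..<N}"
        using input_memory(3)[OF carr] i by (simp add: flag_base_def)
    qed
    moreover have "card {1..<N} = Suc (N - 2)" using N by simp
    moreover have "m3 0 = N" "m3 1 = 1" "m3 4 = weight_base N" "m3 6 = flag_base N" "m3 8 = N - 2" "m3 10 = N"
      using m2 N by (simp_all add: m3_def weight_base_def flag_base_def)
    ultimately have "loop_state S N (N - 2) m3"
      unfolding loop_state_def using greedy_inv_init[of S N]
      by (intro exI[of _ "{1..<N}"] exI[of _ "\<lambda>_. 0"]) simp
    then show "runs (Seq (While 8 iteration_prog) log_prog) (fold effect ?init m2) (22 * (N * N * N * N)) (\<lambda>m'. good_approx S N (m' 0))"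
      unfolding m3_def by (rule runs_greedy_loop[OF S N])
  qed simp_all
  show ?thesis unfolding greedy_prog_def
  proof (rule runs_Block_Seq)
    show "runs (Seq (While 5 (Block ?sq)) (Seq (Block ?init) (Seq (While 8 iteration_prog) log_prog)))
      (fold effect [Const 4 0, Move 5 0] m) (N * (2 + 2) + 1 + (22 * (N * N * N * N) + 5))
      (\<lambda>m'. good_approx S N (m' 0))"
      by (rule runs_Seq, rule runs_mono[OF sq order_refl main])
    have "length [Const 4 0, Move 5 0] = 2" "N * (2 + 2) = 4 * N" by simp_all
    moreover have "30 * (N * N * N) \<le> N * N * N * N"
      using mult_le_mono1[OF N, of "N * N * N"] by (simp add: mult.assoc)
    ultimately show "length [Const 4 0, Move 5 0] + (N * (2 + 2) + 1 + (22 * (N * N * N * N) + 5))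
        \<le> 23 * (N * N * N * N)"
      using square_ge[OF N] cube_ge[OF N] N by linarith
  qed simp
qed

lemma sign_rank_le_dim:
  assumes S: "S \<in> sign_matrices m n"
  shows "sign_rank S \<le> n"
proof (rule sign_rank_witness[OF S])
  fix M assume "M \<in> carrier_mat m n" "vec_space.rank m M = sign_rank S"
  then show ?thesis using vec_space.rank_le_nc[of M m n] by simp
qed

text \<open>\<open>N / ln N\<close> and the sign rank are at least 1, so the upper bound is at least
  124, while the sign rank is at most \<open>N \<le> 30\<close>.\<close>

lemma good_approx_small:
  assumes S: "S \<in> sign_matrices N N" and N: "2 \<le> N" "N \<le> 30"
  shows "good_approx S N 30"
proof -
  have ln: "0 < ln (real N)" using N by simp
  have "1 \<le> real N / ln (real N)" using ln ln_bound[of "real N"] N by simp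
  moreover have "1 \<le> real (sign_rank S)" using sign_rank_pos[OF S] N by simp
  ultimately have "1 * 1 \<le> real N / ln (real N) * real (sign_rank S)"
    by (intro mult_mono) auto
  moreover have "sign_rank S \<le> 30" using sign_rank_le_dim[OF S] N by simp
  ultimately show ?thesis unfolding good_approx_def by simp
qed

text \<open>Halting is needed for every order, the approximation only for \<open>N \<ge> 2\<close>:
  for smaller \<open>N\<close> the quotient \<open>N / ln N\<close> evaluates to 0.\<close>

lemma runs_approx_prog:
  assumes S: "S \<in> sign_matrices N N"
  shows "runs approx_prog (input_memory S) (40 + 23 * (N * N * N * N))
    (\<lambda>m. 2 \<le> N \<longrightarrow> good_approx S N (m 0))"
proof -
  let ?init = "[Const 1 1, Const 2 30, Sub 3 2 0]"
  let ?m = "fold effect ?init (input_memory S)"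
  note m0 = input_memory(1)[OF sign_matricesD(1)[OF S]]
  have m: "?m 0 = N" "?m 1 = 1" "?m 3 = 30 - N" using m0 by simp_all
  show ?thesis unfolding approx_prog_def
  proof (rule runs_Block_Seq)
    show "runs (Cond 3 (Block [Const 0 30]) greedy_prog) ?m (37 + 23 * (N * N * N * N))
      (\<lambda>m. 2 \<le> N \<longrightarrow> good_approx S N (m 0))"
    proof (rule runs_CondI[where T' = "1 + 23 * (N * N * N * N)"])
      assume "?m 3 \<noteq> 0"
      then have "N \<le> 30" unfolding m(3) by simp
      then show "runs (Block [Const 0 30]) ?m (1 + 23 * (N * N * N * N))
        (\<lambda>m. 2 \<le> N \<longrightarrow> good_approx S N (m 0))"
        using good_approx_small[OF S] by (intro runs_Block) simp_all
    next
      assume "?m 3 = 0"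
      then have N: "30 \<le> N" unfolding m(3) by simp
      have "runs greedy_prog ?m (23 * (N * N * N * N)) (\<lambda>m'. good_approx S N (m' 0))"
        by (rule runs_greedy_prog[OF S N m(1,2)]) simp
      then show "runs greedy_prog ?m (1 + 23 * (N * N * N * N)) (\<lambda>m. 2 \<le> N \<longrightarrow> good_approx S N (m 0))"
        by (rule runs_mono) simp_all
    qed simp
  qed simp_all
qed

lemma length_le_input_length: "length xs \<le> input_length xs"
  by (induction xs) (auto simp: input_length_def)

theorem theorem11:
  shows "\<exists>c::real. c > 0 \<and>
    (\<exists>A :: real mat \<Rightarrow> nat.
       poly_time_computable (\<Union>N. sign_matrices N N) encode_sign_matrix A \<and>
       (\<forall>N \<ge> 2. \<forall>S \<in> sign_matrices N N.
          sign_rank S \<le> A S \<and>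
          real (A S) \<le> c * (real N / ln (real N)) * real (sign_rank S)))"
proof -
  define P where "P = compile 0 approx_prog"
  \<comment> \<open>The time bound is a polynomial in \<open>N\<close>, and the input length is at
    least \<open>N * N + 1 \<ge> N\<close>.\<close>
  define p :: "nat poly" where "p = [:40:] + monom 23 4"
  have "\<exists>s. (\<exists>t \<le> poly p (input_length (encode_sign_matrix S)).
      let c = (step P ^^ t) (init_config (encode_sign_matrix S)) in halted P c \<and> snd c 0 = s) \<and>
      (\<forall>N. S \<in> sign_matrices N N \<and> 2 \<le> N \<longrightarrow> good_approx S N s)"
    if "S \<in> (\<Union>N. sign_matrices N N)" for S
  proof -
    from that obtain N where S: "S \<in> sign_matrices N N" by blast
    \<comment> \<open>The domain unites all orders; the dimensions of \<open>S\<close> determine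
      \<open>N\<close>.\<close>
    have uniq: "N' = N" if "S \<in> sign_matrices N' N'" for N'
      using sign_matricesD(1)[OF S] sign_matricesD(1)[OF that] by auto
    obtain t where t: "t \<le> 40 + 23 * (N * N * N * N)"
      "halted P ((step P ^^ t) (0, input_memory S))"
      "2 \<le> N \<longrightarrow> good_approx S N (snd ((step P ^^ t) (0, input_memory S)) 0)"
      using runs_compile[OF runs_approx_prog[OF S]] unfolding P_def[symmetric] Let_def by blast
    have "N \<le> Suc (N * N)" by (simp add: le_SucI le_square)
    also have "\<dots> \<le> input_length (encode_sign_matrix S)"
      using length_le_input_length[of "encode_sign_matrix S"] length_encode[OF sign_matricesD(1)[OF S]] by simp
    finally have "N ^ 4 \<le> input_length (encode_sign_matrix S) ^ 4" by (rule power_mono) simp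
    then have "t \<le> poly p (input_length (encode_sign_matrix S))"
      using t(1) by (simp add: p_def poly_monom numeral_eq_Suc mult.assoc)
    moreover have "init_config (encode_sign_matrix S) = (0, input_memory S)"
      by (simp add: input_memory_def init_config_def)
    ultimately show ?thesis using t(2,3) uniq
      by (intro exI[of _ "snd ((step P ^^ t) (0, input_memory S)) 0"] conjI exI[of _ t])
        (auto simp: Let_def)
  qed
  \<comment> \<open>\<open>A\<close> maps each \<open>S\<close> to the output of \<open>P\<close>,
    by choice over the halting runs.\<close>
  then obtain A where A: "\<And>S. S \<in> (\<Union>N. sign_matrices N N) \<Longrightarrow>
      (\<exists>t \<le> poly p (input_length (encode_sign_matrix S)).
      let c = (step P ^^ t) (init_config (encode_sign_matrix S)) in halted P c \<and> snd c 0 = A S) \<and>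
      (\<forall>N. S \<in> sign_matrices N N \<and> 2 \<le> N \<longrightarrow> good_approx S N (A S))"
    by metis
  have "poly_time_computable (\<Union>N. sign_matrices N N) encode_sign_matrix A"
    unfolding poly_time_computable_def using A by blast
  moreover have "\<forall>N\<ge>2. \<forall>S\<in>sign_matrices N N. sign_rank S \<le> A S \<and>
      real (A S) \<le> 124 * (real N / ln (real N)) * real (sign_rank S)"
    using A unfolding good_approx_def by blast
  ultimately show ?thesis by (intro exI[of _ 124]) auto
qed

end
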